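(* Let $K\in\{\mathbb{R},\mathbb{C},\mathbb{H}\}$, let $d\ge 2$, let $q\in[1,2]$, and let $f:[0,1]\to\mathbb{R}$ be a Borel function. Assume that there are real coefficients $a_0,a_1\ge 0$ and $a_k\le 0$ for $k\ge 2$ (finitely many of the $a_k$ nonzero, or infinitely many with the series converging for every $t\in[0,1]$) such that $$0\le f(t)\le a_0+a_1t^2+\sum_{k\ge 2}a_kQ_{K,d}^{(k)}(t)\qquad\text{for all }t\in[0,1].$$ For $x,y\in K^d$ let $P(x,y)=|x|^q|y|^q f\left(\left|\left\langle \frac{x}{|x|},\frac{y}{|y|}\right\rangle\right|\right)$ if neither $x$ nor $y$ is $0$, and $P(x,y)=0$ otherwise. Then for any isotropic measure $\mu$ on $K^d$, $$\mathbb{E}_{x,y\sim\mu}P(x,y)=\int\int P(x,y)\,d\mu(x)\,d\mu(y)\le \frac{a_1}{d}+a_0 .$$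
   Context: $K^d$ carries the Hermitian product $\langle x,y\rangle=x^*y$ ($x^*$ is the conjugate transpose; for $K=\mathbb{H}$, $K^d$ is a right vector space) and norm $|x|=\sqrt{\langle x,x\rangle}$. An isotropic measure on $K^d$ is a Borel probability measure $\mu$ with $\mathbb{E}_{x\sim\mu}\,xx^*=\frac1d I_d$. In $\mathbb{E}_{x,y\sim\mu}$ the points $x,y$ are independent with law $\mu$. $Q_{K,d}^{(k)}$ denotes the zonal spherical function of $K\mathbb{P}^{d-1}$ written in the variable $t=|\langle x,y\rangle|$ ($x,y$ unit vectors): $Q_{K,d}^{(k)}(t)=P_k^{(\alpha,\beta)}(2t^2-1)/P_k^{(\alpha,\beta)}(1)$, where $P_k^{(\alpha,\beta)}$ is the Jacobi polynomial of degree $k$ (orthogonal on $[-1,1]$ with weight $(1-x)^\alpha(1+x)^\beta$) with $\alpha=(d-1)\frac{\dim_{\mathbb{R}}K}{2}-1$ and $\beta=\frac{\dim_{\mathbb{R}}K}{2}-1$. Thus $Q_{K,d}^{(k)}$ is an even polynomial of degree $2k$ with $Q_{K,d}^{(k)}(1)=1$. *)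

theory Defs
  imports "HOL-Probability.Probability" "HOL-Computational_Algebra.Polynomial"
    "HOL-Computational_Algebra.Formal_Power_Series"
begin

section \<open>The skew field of quaternions\<close>

datatype quat = Quat (qRe: real) (qI: real) (qJ: real) (qK: real)

lemma quat_eq_iff: "x = y \<longleftrightarrow> qRe x = qRe y \<and> qI x = qI y \<and> qJ x = qJ y \<and> qK x = qK y"
  by (auto intro: quat.expand)

lemma four_squares:
  fixes a b c d w x y z :: real
  shows "(a * w - b * x - c * y - d * z)\<^sup>2 + (a * x + b * w + c * z - d * y)\<^sup>2
    + (a * y - b * z + c * w + d * x)\<^sup>2 + (a * z + b * y - c * x + d * w)\<^sup>2
    = (a\<^sup>2 + b\<^sup>2 + c\<^sup>2 + d\<^sup>2) * (w\<^sup>2 + x\<^sup>2 + y\<^sup>2 + z\<^sup>2)"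
  by algebra

instantiation quat :: real_normed_div_algebra
begin

definition "0 = Quat 0 0 0 0"
definition "1 = Quat 1 0 0 0"
definition "x + y = Quat (qRe x + qRe y) (qI x + qI y) (qJ x + qJ y) (qK x + qK y)"
definition "- x = Quat (- qRe x) (- qI x) (- qJ x) (- qK x)"
definition "x - y = Quat (qRe x - qRe y) (qI x - qI y) (qJ x - qJ y) (qK x - qK y)"
definition "r *\<^sub>R x = Quat (r * qRe x) (r * qI x) (r * qJ x) (r * qK x)"
definition times_quat_def: "x * y = Quat
   (qRe x * qRe y - qI x * qI y - qJ x * qJ y - qK x * qK y)
   (qRe x * qI y + qI x * qRe y + qJ x * qK y - qK x * qJ y)
   (qRe x * qJ y - qI x * qK y + qJ x * qRe y + qK x * qI y)
   (qRe x * qK y + qI x * qJ y - qJ x * qI y + qK x * qRe y)"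
definition norm_quat_def: "norm x = sqrt ((qRe x)\<^sup>2 + (qI x)\<^sup>2 + (qJ x)\<^sup>2 + (qK x)\<^sup>2)"
definition inverse_quat_def:
  "inverse x = (1 / (norm x)\<^sup>2) *\<^sub>R Quat (qRe x) (- qI x) (- qJ x) (- qK x)"
definition divide_quat_def: "x div (y :: quat) = x * inverse y"
definition sgn_quat_def: "sgn x = inverse (norm x) *\<^sub>R (x :: quat)"
definition dist_quat_def: "dist x y = norm (x - y :: quat)"
definition uniformity_quat_def [code del]:
  "(uniformity :: (quat \<times> quat) filter) = (INF e\<in>{0 <..}. principal {(x, y). dist x y < e})"
definition open_quat_def [code del]:
  "open (U :: quat set) \<longleftrightarrow> (\<forall>x\<in>U. eventually (\<lambda>(x', y). x' = x \<longrightarrow> y \<in> U) uniformity)"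

lemmas quat_ops = zero_quat_def one_quat_def plus_quat_def uminus_quat_def minus_quat_def
  scaleR_quat_def times_quat_def

lemma norm_quat_sq: "(norm (x :: quat))\<^sup>2 = (qRe x)\<^sup>2 + (qI x)\<^sup>2 + (qJ x)\<^sup>2 + (qK x)\<^sup>2"
  by (simp add: norm_quat_def)

lemma norm_quat_zero_iff: "norm (x :: quat) = 0 \<longleftrightarrow> x = 0"
proof -
  have "norm x = 0 \<longleftrightarrow> (qRe x)\<^sup>2 + (qI x)\<^sup>2 + (qJ x)\<^sup>2 + (qK x)\<^sup>2 = 0"
    by (simp add: norm_quat_def)
  also have "\<dots> \<longleftrightarrow> x = 0"
    by (auto simp: quat_eq_iff quat_ops add_nonneg_eq_0_iff)
  finally show ?thesis .
qed

lemma norm_quat_triangle: "norm (x + y :: quat) \<le> norm x + norm y"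
proof -
  have L: "norm z = L2_set (\<lambda>i. [qRe z, qI z, qJ z, qK z] ! i) {..<4}" for z
    by (simp add: norm_quat_def L2_set_def numeral_eq_Suc)
  have "norm (x + y) = L2_set (\<lambda>i. [qRe x, qI x, qJ x, qK x] ! i + [qRe y, qI y, qJ y, qK y] ! i) {..<4}"
    by (simp add: L plus_quat_def L2_set_def numeral_eq_Suc)
  also have "\<dots> \<le> norm x + norm y"
    unfolding L by (rule L2_set_triangle_ineq)
  finally show ?thesis .
qed

instance
proof
  fix x y z :: quat and r s :: real
  show "x + y + z = x + (y + z)" "x + y = y + x" "0 + x = x" "- x + x = 0" "x - y = x + - y"
    by (simp_all add: quat_ops)
  show "r *\<^sub>R (x + y) = r *\<^sub>R x + r *\<^sub>R y" "(r + s) *\<^sub>R x = r *\<^sub>R x + s *\<^sub>R x"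
    "r *\<^sub>R s *\<^sub>R x = (r * s) *\<^sub>R x" "1 *\<^sub>R x = x"
    by (simp_all add: quat_ops algebra_simps)
  show "x * y * z = x * (y * z)" "(x + y) * z = x * z + y * z" "x * (y + z) = x * y + x * z"
    "r *\<^sub>R x * y = r *\<^sub>R (x * y)" "x * r *\<^sub>R y = r *\<^sub>R (x * y)"
    by (simp_all add: quat_ops algebra_simps)
  show "1 * x = x" "x * 1 = x" "(0 :: quat) \<noteq> 1"
    by (simp_all add: quat_ops)
  show "x div y = x * inverse y" by (fact divide_quat_def)
  show "inverse (0 :: quat) = 0" by (simp add: inverse_quat_def quat_ops)
  show "inverse x * x = 1" "x * inverse x = 1" if "x \<noteq> 0"
  proof -
    have ne: "(norm x)\<^sup>2 \<noteq> 0" using that norm_quat_zero_iff by simp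
    let ?y = "Quat (qRe x) (- qI x) (- qJ x) (- qK x)"
    have "?y * x = Quat ((norm x)\<^sup>2) 0 0 0" "x * ?y = Quat ((norm x)\<^sup>2) 0 0 0"
      unfolding norm_quat_sq by (simp_all add: times_quat_def power2_eq_square)
    note prods = this
    have scale: "r *\<^sub>R ?y * x = r *\<^sub>R (?y * x)" "x * r *\<^sub>R ?y = r *\<^sub>R (x * ?y)" for r
      by (simp_all add: quat_ops algebra_simps)
    show "inverse x * x = 1" "x * inverse x = 1"
      unfolding inverse_quat_def scale prods using ne by (simp_all add: scaleR_quat_def one_quat_def)
  qed
  show "norm x = 0 \<longleftrightarrow> x = 0" by (fact norm_quat_zero_iff)
  show "norm (x + y) \<le> norm x + norm y" by (fact norm_quat_triangle)
  show "norm (r *\<^sub>R x) = \<bar>r\<bar> * norm x"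
  proof -
    have "(norm (r *\<^sub>R x))\<^sup>2 = (\<bar>r\<bar> * norm x)\<^sup>2"
      unfolding power_mult_distrib norm_quat_sq by (simp add: scaleR_quat_def power_mult_distrib distrib_left)
    then show ?thesis by (rule power2_eq_imp_eq) (simp_all add: norm_quat_def)
  qed
  show "norm (x * y) = norm x * norm y"
  proof -
    have "(norm (x * y))\<^sup>2 = (norm x * norm y)\<^sup>2"
      unfolding power_mult_distrib norm_quat_sq by (simp only: times_quat_def quat.sel four_squares)
    then show ?thesis by (rule power2_eq_imp_eq) (simp_all add: norm_quat_def)
  qed
qed (rule sgn_quat_def dist_quat_def open_quat_def uniformity_quat_def)+

end

instantiation quat :: euclidean_space
begin

definition inner_quat_def: "x \<bullet> y = qRe x * qRe y + qI x * qI y + qJ x * qJ y + qK x * qK y"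
definition Basis_quat_def:
  "Basis = {Quat 1 0 0 0, Quat 0 1 0 0, Quat 0 0 1 0, Quat 0 0 0 1}"

instance
proof
  fix x y z :: quat and r :: real
  show "x \<bullet> y = y \<bullet> x" "(x + y) \<bullet> z = x \<bullet> z + y \<bullet> z" "r *\<^sub>R x \<bullet> y = r * (x \<bullet> y)"
    by (simp_all add: inner_quat_def quat_ops algebra_simps)
  have sq: "x \<bullet> x = (norm x)\<^sup>2"
    unfolding norm_quat_sq by (simp add: inner_quat_def power2_eq_square)
  show "0 \<le> x \<bullet> x" "norm x = sqrt (x \<bullet> x)" "x \<bullet> x = 0 \<longleftrightarrow> x = 0"
    by (simp_all add: sq)
  show "(\<forall>u\<in>Basis. x \<bullet> u = 0) \<longleftrightarrow> x = 0"
    unfolding Basis_quat_def by (cases x) (auto simp: inner_quat_def zero_quat_def)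
qed (auto simp: Basis_quat_def inner_quat_def)

end

lemma DIM_quat [simp]: "DIM(quat) = 4"
  by (simp add: Basis_quat_def)


section \<open>Scalars with a conjugation, and the Hermitian product\<close>

class conj_div_algebra = real_normed_div_algebra + euclidean_space +
  fixes kconj :: "'a \<Rightarrow> 'a"
  assumes kconj_add: "kconj (x + y) = kconj x + kconj y"
    and kconj_scaleR: "kconj (r *\<^sub>R x) = r *\<^sub>R kconj x"
    and kconj_mult: "kconj (x * y) = kconj y * kconj x"
    and kconj_mult_self: "kconj x * x = (norm x)\<^sup>2 *\<^sub>R 1"

instantiation real :: conj_div_algebra
begin
definition kconj_real_def: "kconj (x :: real) = x"
instance by standard (auto simp: kconj_real_def power2_eq_square)
end

instantiation complex :: conj_div_algebra
begin
definition kconj_complex_def: "kconj (x :: complex) = cnj x"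
instance
proof
  fix x y :: complex and r :: real
  show "kconj (x + y) = kconj x + kconj y" "kconj (r *\<^sub>R x) = r *\<^sub>R kconj x"
    "kconj (x * y) = kconj y * kconj x"
    by (simp_all add: kconj_complex_def mult.commute)
  show "kconj x * x = (norm x)\<^sup>2 *\<^sub>R 1"
    unfolding kconj_complex_def scaleR_conv_of_real complex_norm_square by simp
qed
end

instantiation quat :: conj_div_algebra
begin
definition kconj_quat_def: "kconj x = Quat (qRe x) (- qI x) (- qJ x) (- qK x)"
instance
proof
  fix x y :: quat and r :: real
  show "kconj (x + y) = kconj x + kconj y" "kconj (r *\<^sub>R x) = r *\<^sub>R kconj x"
    "kconj (x * y) = kconj y * kconj x"
    by (simp_all add: kconj_quat_def quat_ops mult.commute)
  show "kconj x * x = (norm x)\<^sup>2 *\<^sub>R 1"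
    unfolding norm_quat_sq by (simp add: kconj_quat_def quat_ops power2_eq_square)
qed
end

definition herm :: "('k::conj_div_algebra)^'n \<Rightarrow> 'k^'n \<Rightarrow> 'k" where
  "herm x y = (\<Sum>i\<in>UNIV. kconj (x $ i) * y $ i)"

text \<open>Hence the library norm on \<^typ>\<open>('k::conj_div_algebra)^'n\<close> is the one induced by \<^const>\<open>herm\<close>.\<close>

lemma herm_self: "herm x x = of_real ((norm x)\<^sup>2)"
  by (simp add: herm_def kconj_mult_self of_real_def scaleR_left.sum[symmetric] norm_vec_def L2_set_def sum_nonneg)

text \<open>The matrix \<open>x x\<^sup>*\<close>.\<close>

definition outer_self :: "('k::conj_div_algebra)^'n \<Rightarrow> 'k^'n^'n" where
  "outer_self x = (\<chi> i j. x $ i * kconj (x $ j))"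

definition isotropic :: "(('k::conj_div_algebra)^'n) measure \<Rightarrow> bool" where
  "isotropic \<mu> \<longleftrightarrow> prob_space \<mu> \<and> sets \<mu> = sets borel \<and>
     has_bochner_integral \<mu> outer_self ((1 / real CARD('n)) *\<^sub>R mat 1)"


section \<open>Jacobi polynomials and zonal spherical functions\<close>

definition jacobi_poly :: "real \<Rightarrow> real \<Rightarrow> nat \<Rightarrow> real poly" where
  "jacobi_poly \<alpha> \<beta> n = (\<Sum>s\<le>n. smult (((real n + \<alpha>) gchoose (n - s)) * ((real n + \<beta>) gchoose s))
      ([:- 1/2, 1/2:] ^ s * [:1/2, 1/2:] ^ (n - s)))"

text \<open>\<^const>\<open>jacobi_poly\<close> has degree \<open>n\<close> and is orthogonal, for the Jacobi weight, to all
  polynomials of smaller degree.\<close>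

lemma poly_jacobi_1: "poly (jacobi_poly \<alpha> \<beta> n) 1 = (real n + \<alpha>) gchoose n"
proof -
  have "poly (jacobi_poly \<alpha> \<beta> n) 1 = (\<Sum>s\<le>n. if s = 0 then (real n + \<alpha>) gchoose n else 0)"
    unfolding jacobi_poly_def poly_sum by (intro sum.cong) (auto simp: poly_power)
  then show ?thesis by simp
qed

lemma degree_jacobi_poly:
  assumes "\<alpha> > -1" "\<beta> > -1"
  shows "degree (jacobi_poly \<alpha> \<beta> n) = n"
proof (rule antisym)
  have d: "degree ([:- 1/2, 1/2 :: real:] ^ s * [:1/2, 1/2:] ^ (n - s)) = n" if "s \<le> n" for s
    using that by (subst degree_mult_eq) (auto simp: degree_power_eq)
  show "degree (jacobi_poly \<alpha> \<beta> n) \<le> n"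
    unfolding jacobi_poly_def
    by (intro degree_sum_le) (simp_all only: order.trans[OF degree_smult_le] d atMost_iff finite_atMost order.refl)
  have lc: "coeff ([:- 1/2, 1/2 :: real:] ^ s * [:1/2, 1/2:] ^ (n - s)) n = (1/2) ^ n" if "s \<le> n" for s
  proof -
    have "coeff ([:- 1/2, 1/2 :: real:] ^ s * [:1/2, 1/2:] ^ (n - s)) n
        = lead_coeff ([:- 1/2, 1/2 :: real:] ^ s * [:1/2, 1/2:] ^ (n - s))"
      using d[OF that] by simp
    also have "\<dots> = (1/2) ^ s * (1/2) ^ (n - s)"
      by (simp add: lead_coeff_mult lead_coeff_power del: power_one_over)
    also have "\<dots> = (1/2) ^ n" using that by (simp add: flip: power_add)
    finally show ?thesis .
  qed
  have "coeff (jacobi_poly \<alpha> \<beta> n) n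
      = (\<Sum>s\<le>n. ((real n + \<beta>) gchoose s) * ((real n + \<alpha>) gchoose (n - s))) * (1/2) ^ n"
    unfolding jacobi_poly_def coeff_sum sum_distrib_right
    by (intro sum.cong) (auto simp only: coeff_smult lc atMost_iff mult_ac)
  also have "\<dots> = ((real n + \<beta> + (real n + \<alpha>)) gchoose n) * (1/2) ^ n"
    by (subst gbinomial_Vandermonde[symmetric]) (simp add: atLeast0AtMost)
  finally have c: "coeff (jacobi_poly \<alpha> \<beta> n) n = ((real n + \<beta> + (real n + \<alpha>)) gchoose n) * (1/2) ^ n" .
  have "(\<Prod>i = 0..<n. real n + \<beta> + (real n + \<alpha>) - real i) > 0"
    using assms by (intro prod_pos) auto
  then have "coeff (jacobi_poly \<alpha> \<beta> n) n \<noteq> 0"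
    unfolding c gbinomial_prod_rev by (simp del: prod_zero_iff)
  then show "n \<le> degree (jacobi_poly \<alpha> \<beta> n)" by (rule le_degree)
qed

lemma alternating_pochhammer:
  assumes "j < n"
  shows "(\<Sum>s\<le>n. (-1) ^ s * real (n choose s) * pochhammer (c - real s) j) = 0"
  using assms
proof (induction n arbitrary: j c)
  case (Suc n)
  let ?F = "\<lambda>j c. \<Sum>s\<le>n. (-1) ^ s * real (n choose s) * pochhammer (c - real s) j"
  have P: "pochhammer y j - pochhammer (y - 1) j = real j * pochhammer y (j - 1)" for y :: real
  proof (cases j)
    case (Suc i)
    have "pochhammer y (Suc i) = pochhammer y i * (y + real i)"
      by (simp add: pochhammer_Suc mult.commute)
    moreover have "pochhammer (y - 1) (Suc i) = (y - 1) * pochhammer y i"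
      by (simp add: pochhammer_rec)
    ultimately show ?thesis using Suc by (simp add: algebra_simps)
  qed simp
  have "(\<Sum>s\<le>Suc n. (-1) ^ s * real (Suc n choose s) * pochhammer (c - real s) j)
      = pochhammer c j + (\<Sum>s\<le>n. (-1) ^ Suc s * real (Suc n choose Suc s) * pochhammer (c - real (Suc s)) j)"
    by (subst sum.atMost_Suc_shift) simp
  also have "\<dots> = pochhammer c j + (\<Sum>s\<le>n. (-1) ^ Suc s * real (n choose Suc s) * pochhammer (c - real (Suc s)) j)
       - ?F j (c - 1)"
    by (simp add: algebra_simps sum.distrib sum_negf sum_subtractf)
  also have "pochhammer c j + (\<Sum>s\<le>n. (-1) ^ Suc s * real (n choose Suc s) * pochhammer (c - real (Suc s)) j)
      = (\<Sum>s\<le>Suc n. (-1) ^ s * real (n choose s) * pochhammer (c - real s) j)"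
    by (simp only: sum.atMost_Suc_shift) simp
  also have "\<dots> = ?F j c" by simp
  also have "?F j c - ?F j (c - 1) = (\<Sum>s\<le>n. (-1) ^ s * real (n choose s) *
      (pochhammer (c - real s) j - pochhammer (c - real s - 1) j))"
    by (simp add: sum_subtractf right_diff_distrib algebra_simps)
  also have "\<dots> = real j * ?F (j - 1) c"
    unfolding P by (simp add: sum_distrib_left mult_ac)
  also have "\<dots> = 0" using Suc by (cases j) auto
  finally show ?case .
qed simp

lemma has_integral_Beta_symmetric:
  fixes a b :: real
  assumes "a > -1" "b > -1"
  shows "((\<lambda>x. (1 - x) powr a * (1 + x) powr b) has_integral 2 powr (a + b + 1) * Beta (b + 1) (a + 1)) {-1..1}"
proof -
  have "((\<lambda>t. t powr b * (1 - t) powr a) has_integral Beta (b + 1) (a + 1)) {0..1}"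
    using has_integral_Beta_real[of "b + 1" "a + 1"] assms by simp
  from has_integral_affinity[OF this[unfolded cbox_interval[symmetric]], of "1/2" "1/2"]
  have *: "((\<lambda>x. (x / 2 + 1 / 2) powr b * (1 - (x / 2 + 1 / 2)) powr a) has_integral
      2 * Beta (b + 1) (a + 1)) ((\<lambda>x. 2 * x - 1) ` {0..1})"
    by (simp add: algebra_simps)
  have img: "(\<lambda>x. 2 * x - 1) ` {0..1} = {-1..1 :: real}"
    using image_affinity_atLeastAtMost[of 2 "-1" 0 "1::real"] by simp
  have "((\<lambda>x. 2 powr (a + b) * ((x / 2 + 1 / 2) powr b * (1 - (x / 2 + 1 / 2)) powr a)) has_integral
      2 powr (a + b) * (2 * Beta (b + 1) (a + 1))) {-1..1}"
    using * unfolding img by (rule has_integral_mult_right)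
  also have "2 powr (a + b) * (2 * Beta (b + 1) (a + 1)) = 2 powr (a + b + 1) * Beta (b + 1) (a + 1)"
    by (simp add: powr_add)
  finally show ?thesis
  proof (rule has_integral_eq_rhs[OF has_integral_eq, rotated])
    fix x :: real assume "x \<in> {-1..1}"
    then have "(x / 2 + 1 / 2) powr b = (1 + x) powr b / 2 powr b"
      "(1 - (x / 2 + 1 / 2)) powr a = (1 - x) powr a / 2 powr a"
      by (subst powr_divide[symmetric]; simp add: field_simps)+
    then show "2 powr (a + b) * ((x / 2 + 1 / 2) powr b * (1 - (x / 2 + 1 / 2)) powr a)
        = (1 - x) powr a * (1 + x) powr b"
      by (simp add: powr_add)
  qed simp
qed

lemma gbinomial_Gamma_real:
  fixes c :: real
  assumes "c > -1" "k \<le> n"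
  shows "(real n + c) gchoose k = Gamma (real n + c + 1) / (fact k * Gamma (real (n - k) + c + 1))"
  using assms
  by (subst gbinomial_Gamma) (auto simp: of_nat_diff algebra_simps)

lemma jacobi_integral_power:
  fixes \<alpha> \<beta> :: real
  assumes ab: "\<alpha> > -1" "\<beta> > -1" and "j < n"
  shows "((\<lambda>x. (1 - x) powr \<alpha> * (1 + x) powr \<beta> * (poly (jacobi_poly \<alpha> \<beta> n) x * (1 + x) ^ j))
    has_integral 0) {-1..1}"
proof -
  define c where "c s = ((real n + \<alpha>) gchoose (n - s)) * ((real n + \<beta>) gchoose s)" for s
  define I where "I s = 2 powr ((\<alpha> + real s) + (\<beta> + real (n - s + j)) + 1) *
      Beta (\<beta> + real (n - s + j) + 1) (\<alpha> + real s + 1)" for s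
  define K where "K = (1/2) ^ n * 2 powr (\<alpha> + \<beta> + real (n + j) + 1) * Gamma (real n + \<alpha> + 1)
      * Gamma (real n + \<beta> + 1) / Gamma (\<alpha> + \<beta> + real (n + j) + 2)"
  have "((\<lambda>x. \<Sum>s\<le>n. (c s * (-1) ^ s * (1/2) ^ n) *
          ((1 - x) powr (\<alpha> + real s) * (1 + x) powr (\<beta> + real (n - s + j))))
      has_integral (\<Sum>s\<le>n. (c s * (-1) ^ s * (1/2) ^ n) * I s)) {-1..1}"
    unfolding I_def using ab
    by (intro has_integral_sum has_integral_mult_right has_integral_Beta_symmetric) auto
  also have "(\<Sum>s\<le>n. (c s * (-1) ^ s * (1/2) ^ n) * I s)
      = (\<Sum>s\<le>n. K / fact n * ((-1) ^ s * real (n choose s) * pochhammer (real n + \<beta> + 1 - real s) j))"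
  proof (rule sum.cong[OF refl])
    fix s assume "s \<in> {..n}"
    then have s: "s \<le> n" by simp
    have c: "c s = Gamma (real n + \<alpha> + 1) / (fact (n - s) * Gamma (real s + \<alpha> + 1)) *
        (Gamma (real n + \<beta> + 1) / (fact s * Gamma (real (n - s) + \<beta> + 1)))"
      using ab s unfolding c_def by (subst (1 2) gbinomial_Gamma_real) auto
    have "real (n - s) + \<beta> + 1 > 0" using ab by simp
    then have "real (n - s) + \<beta> + 1 \<notin> \<int>\<^sub>\<le>\<^sub>0" by (auto elim!: nonpos_Ints_cases)
    then have "pochhammer (real (n - s) + \<beta> + 1) j
        = Gamma (real (n - s) + \<beta> + 1 + real j) / Gamma (real (n - s) + \<beta> + 1)"
      by (rule pochhammer_Gamma)
    also have "real (n - s) + \<beta> + 1 = real n + \<beta> + 1 - real s" using s by (simp add: of_nat_diff)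
    finally have p: "pochhammer (real n + \<beta> + 1 - real s) j
        = Gamma (real n + \<beta> + 1 - real s + real j) / Gamma (real n + \<beta> + 1 - real s)" .
    have pos: "Gamma (real s + \<alpha> + 1) > 0" using ab by (intro Gamma_real_pos) auto
    have e: "real (n - s) + \<beta> + 1 = real n + \<beta> + 1 - real s"
      "\<beta> + real (n - s + j) + 1 = real n + \<beta> + 1 - real s + real j"
      "\<alpha> + real s + 1 = real s + \<alpha> + 1"
      "(\<alpha> + real s) + (\<beta> + real (n - s + j)) + 1 = \<alpha> + \<beta> + real (n + j) + 1"
      "real n + \<beta> + 1 - real s + real j + (real s + \<alpha> + 1) = \<alpha> + \<beta> + real (n + j) + 2"
      using s by (simp_all add: of_nat_diff)
    show "(c s * (-1) ^ s * (1/2) ^ n) * I s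
        = K / fact n * ((-1) ^ s * real (n choose s) * pochhammer (real n + \<beta> + 1 - real s) j)"
      unfolding c I_def Beta_def p K_def binomial_fact[OF s] e using pos by (simp add: mult_ac)
  qed
  also have "\<dots> = 0"
    unfolding sum_distrib_left[symmetric] alternating_pochhammer[OF \<open>j < n\<close>] by simp
  finally show ?thesis
  proof (rule has_integral_eq[rotated])
    fix x :: real assume x: "x \<in> {-1..1}"
    have pw: "y powr e * y ^ k = y powr (e + real k)" if "y \<ge> 0" for y e :: real and k
      using that by (cases "y = 0") (auto simp: powr_add powr_realpow)
    show "(\<Sum>s\<le>n. (c s * (-1) ^ s * (1/2) ^ n) *
          ((1 - x) powr (\<alpha> + real s) * (1 + x) powr (\<beta> + real (n - s + j))))
        = (1 - x) powr \<alpha> * (1 + x) powr \<beta> * (poly (jacobi_poly \<alpha> \<beta> n) x * (1 + x) ^ j)"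
      unfolding jacobi_poly_def poly_sum sum_distrib_left sum_distrib_right
    proof (rule sum.cong[OF refl])
      fix s assume "s \<in> {..n}"
      then have s: "s \<le> n" by simp
      have "poly ([:- 1/2, 1/2:] ^ s * [:1/2, 1/2:] ^ (n - s)) x
          = ((-1) * ((1/2) * (1 - x))) ^ s * ((1/2) * (1 + x)) ^ (n - s)"
        by (simp add: diff_divide_distrib add_divide_distrib add.commute)
      also have "\<dots> = (-1) ^ s * ((1/2) ^ s * (1/2) ^ (n - s)) * ((1 - x) ^ s * (1 + x) ^ (n - s))"
        unfolding power_mult_distrib by (simp only: mult_ac)
      also have "(1/2) ^ s * (1/2) ^ (n - s) = (1/2 :: real) ^ n"
        using s by (simp flip: power_add)
      finally have E: "poly ([:- 1/2, 1/2:] ^ s * [:1/2, 1/2:] ^ (n - s)) x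
          = (-1) ^ s * (1/2) ^ n * ((1 - x) ^ s * (1 + x) ^ (n - s))" .
      have q1: "(1 - x) powr (\<alpha> + real s) = (1 - x) powr \<alpha> * (1 - x) ^ s"
        using x by (intro pw[symmetric]) simp
      have q2: "(1 + x) powr (\<beta> + real (n - s + j)) = (1 + x) powr \<beta> * ((1 + x) ^ (n - s) * (1 + x) ^ j)"
        unfolding power_add[symmetric] using x by (intro pw[symmetric]) simp
      show "(c s * (-1) ^ s * (1/2) ^ n) *
          ((1 - x) powr (\<alpha> + real s) * (1 + x) powr (\<beta> + real (n - s + j))) =
          (1 - x) powr \<alpha> * (1 + x) powr \<beta> * (poly (smult (((real n + \<alpha>) gchoose (n - s)) *
            ((real n + \<beta>) gchoose s)) ([:- 1/2, 1/2:] ^ s * [:1/2, 1/2:] ^ (n - s))) x * (1 + x) ^ j)"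
        unfolding poly_smult E q1 q2 c_def by (simp only: mult_ac)
    qed
  qed
qed

theorem jacobi_poly_orthogonal:
  fixes \<alpha> \<beta> :: real
  assumes "\<alpha> > -1" "\<beta> > -1" and "degree r < n"
  shows "((\<lambda>x. (1 - x) powr \<alpha> * (1 + x) powr \<beta> * (poly (jacobi_poly \<alpha> \<beta> n) x * poly r x))
    has_integral 0) {-1..1}"
proof -
  define p where "p = pcompose r [:-1, 1:]"
  have deg: "degree p < n" using assms(3) by (simp add: p_def degree_pcompose)
  have r: "poly r x = (\<Sum>j\<le>degree p. coeff p j * (1 + x) ^ j)" for x
    unfolding poly_altdef[symmetric] by (simp add: p_def poly_pcompose)
  have "((\<lambda>x. \<Sum>j\<le>degree p. coeff p j * ((1 - x) powr \<alpha> * (1 + x) powr \<beta> *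
      (poly (jacobi_poly \<alpha> \<beta> n) x * (1 + x) ^ j))) has_integral (\<Sum>j\<le>degree p. coeff p j * 0)) {-1..1}"
    using assms deg by (intro has_integral_sum has_integral_mult_right jacobi_integral_power) auto
  then show ?thesis by (simp add: r sum_distrib_left mult_ac)
qed

text \<open>Here \<open>m\<close> is the real dimension of the scalars and \<open>d\<close> the dimension of the space.\<close>

definition zonal :: "nat \<Rightarrow> nat \<Rightarrow> nat \<Rightarrow> real \<Rightarrow> real" where
  "zonal m d k t =
     (let J = jacobi_poly ((real d - 1) * (real m / 2) - 1) (real m / 2 - 1) k
      in poly J (2 * t\<^sup>2 - 1) / poly J 1)"

definition zonal_dominated :: "nat \<Rightarrow> nat \<Rightarrow> (nat \<Rightarrow> real) \<Rightarrow> (real \<Rightarrow> real) \<Rightarrow> bool" where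
  "zonal_dominated m d a f \<longleftrightarrow> (\<forall>t\<in>{0..1}.
     summable (\<lambda>k. a (k + 2) * zonal m d (k + 2) t) \<and>
     0 \<le> f t \<and> f t \<le> a 0 + a 1 * t\<^sup>2 + (\<Sum>k. a (k + 2) * zonal m d (k + 2) t))"

definition pot :: "real \<Rightarrow> (real \<Rightarrow> real) \<Rightarrow> ('k::conj_div_algebra)^'n \<Rightarrow> 'k^'n \<Rightarrow> real" where
  "pot q f x y = (if x \<noteq> 0 \<and> y \<noteq> 0
     then norm x powr q * norm y powr q * f (norm (herm (x /\<^sub>R norm x) (y /\<^sub>R norm y))) else 0)"

end

theory Submission
  imports Defs
begin

text \<open>
  Write \<open>F(x,y) = |\<langle>x,y\<rangle>|\<^sup>2\<close>, which is the inner product of \<open>xx\<^sup>*\<close> and \<open>yy\<^sup>*\<close>, so that \<open>F\<^sup>k\<close> is a positive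
  semidefinite kernel. The homogenised zonal function \<open>K(x,y)\<close> of degree \<open>k\<close> is harmonic in \<open>x\<close>, and
  \<open>K = c\<^sub>0 F\<^sup>k + |x|\<^sup>2|y|\<^sup>2(\<dots>)\<close> with \<open>c\<^sub>0 > 0\<close>. Given weights \<open>w(x)\<close> on a finite set, the function
  \<open>p = \<Sum>w(x) K(\<sqdot>,x)\<close> is a combination \<open>\<Sum>c(z) F(z,\<sqdot>)\<^sup>k\<close>, and harmonicity of \<open>p\<close> kills the moments
  \<open>\<Sum>c(z) |z|\<^sup>2\<^sup>j F(z,\<sqdot>)\<^sup>k\<^sup>-\<^sup>j\<close> for \<open>j \<ge> 1\<close>. Hence
  \<open>0 \<le> \<Sum>\<Sum>c(z)c(z') F(z,z')\<^sup>k = \<Sum>c(z)p(z) = c\<^sub>0 \<Sum>\<Sum>w(x)w(y) K(x,y)\<close>: the zonal functions are positive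
  semidefinite, so the terms with \<open>a\<^sub>k \<le> 0\<close> contribute nonpositively to the expectation.

  The two remaining terms are bounded through
  \<open>|x|\<^sup>q|y|\<^sup>q \<le> (q - 1)|x|\<^sup>2|y|\<^sup>2 + (2 - q)(|x|\<^sup>2 + |y|\<^sup>2)/2\<close>, as isotropy gives \<open>\<^bold>E|x|\<^sup>2 = 1\<close> and
  \<open>\<^bold>E|\<langle>x,v\<rangle>|\<^sup>2 = |v|\<^sup>2/d\<close>.
\<close>

section \<open>The Hermitian product and its squared modulus\<close>

lemma kconj_0 [simp]: "kconj (0 :: 'k::conj_div_algebra) = 0"
  using kconj_scaleR[of 0 "0 :: 'k"] by simp

lemma kconj_1 [simp]: "kconj (1 :: 'k::conj_div_algebra) = 1"
  using kconj_mult_self[of "1 :: 'k"] by simp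

lemma norm_kconj [simp]: "norm (kconj (x :: 'k::conj_div_algebra)) = norm x"
proof (cases "x = 0")
  case False
  have "norm (kconj x) * norm x = norm x * norm x"
    using arg_cong[OF kconj_mult_self[of x], of norm]
    by (simp add: norm_mult power2_eq_square)
  then show ?thesis using False by simp
qed simp

text \<open>Involutivity is not an axiom of the class: \<open>kconj x * x\<close> is a real multiple
  of 1, hence fixed by conjugation, and then \<open>kconj x\<close> can be cancelled.\<close>

lemma kconj_kconj [simp]: "kconj (kconj (x :: 'k::conj_div_algebra)) = x"
proof (cases "x = 0")
  case False
  have "kconj x * kconj (kconj x) = kconj x * x"
    using kconj_mult[of "kconj x" x] by (simp add: kconj_mult_self kconj_scaleR)
  moreover have "kconj x \<noteq> 0" using False norm_kconj[of x] by (metis norm_eq_zero)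
  ultimately show ?thesis by simp
qed simp

text \<open>Polarisation of \<open>kconj_mult_self\<close>; it ties the conjugation to the inner
  product of the Euclidean structure.\<close>

lemma kconj_inner_polar:
  fixes x y :: "'k::conj_div_algebra"
  shows "kconj x * y + kconj y * x = (2 * (x \<bullet> y)) *\<^sub>R 1"
proof -
  have "kconj (x + y) * (x + y) = kconj x * x + (kconj x * y + kconj y * x) + kconj y * y"
    by (simp add: kconj_add algebra_simps)
  then have "kconj x * y + kconj y * x = ((norm (x + y))\<^sup>2 - (norm x)\<^sup>2 - (norm y)\<^sup>2) *\<^sub>R 1"
    unfolding kconj_mult_self by (simp add: algebra_simps)
  also have "(norm (x + y))\<^sup>2 - (norm x)\<^sup>2 - (norm y)\<^sup>2 = 2 * (x \<bullet> y)"
    by (simp add: power2_norm_eq_inner inner_add_left inner_add_right inner_commute)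
  finally show ?thesis .
qed

text \<open>Both sides have the same polar form in \<open>kconj_inner_polar\<close>. The adjoint
  rules stand in for commutativity, which fails for quaternions.\<close>

lemma inner_mult_left_adjoint:
  fixes a x c :: "'k::conj_div_algebra"
  shows "(kconj a * x) \<bullet> c = x \<bullet> (a * c)"
proof -
  have "(2 * ((kconj a * x) \<bullet> c)) *\<^sub>R (1::'k) = (2 * (x \<bullet> (a * c))) *\<^sub>R 1"
    unfolding kconj_inner_polar[symmetric] by (simp add: kconj_mult mult.assoc)
  then show ?thesis by simp
qed

lemma inner_kconj: "kconj x \<bullet> kconj y = x \<bullet> (y :: 'k::conj_div_algebra)"
  unfolding dot_norm by (simp flip: kconj_add)

lemma inner_mult_right_adjoint:
  fixes a x c :: "'k::conj_div_algebra"
  shows "(x * kconj a) \<bullet> c = x \<bullet> (c * a)"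
  using inner_mult_left_adjoint[of "kconj a" "kconj x" "kconj c"] 
    inner_kconj[of "x * kconj a" c] inner_kconj[of x "c * a"]
  by (simp add: kconj_mult)

lemma kconj_sum: "kconj (sum f A) = (\<Sum>i\<in>A. kconj (f i :: 'k::conj_div_algebra))"
  by (induction A rule: infinite_finite_induct) (auto simp: kconj_add)

lemma kconj_herm: "kconj (herm x y) = herm y x"
  by (simp add: herm_def kconj_sum kconj_mult)

section \<open>The squared Hermitian product as a Gram kernel\<close>

definition hsq :: "('k::conj_div_algebra)^'n \<Rightarrow> 'k^'n \<Rightarrow> real" where
  "hsq x y = (norm (herm x y))\<^sup>2"

lemma hsq_commute: "hsq x y = hsq y x"
  unfolding hsq_def by (metis kconj_herm norm_kconj)

lemma herm_add_right: "herm x (y + z) = herm x y + herm x z"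
  by (simp add: herm_def distrib_left sum.distrib)

lemma herm_scaleR_right: "herm x (r *\<^sub>R y) = r *\<^sub>R herm x y"
  by (simp add: herm_def scaleR_sum_right)

lemma inner_herm: "herm y x \<bullet> c = x \<bullet> (\<chi> i. y $ i * c)"
  by (simp add: herm_def inner_sum_left inner_mult_left_adjoint inner_vec_def)

lemma norm_sq_vec_mult: "(norm (\<chi> i. y $ i * c))\<^sup>2 = (norm (y :: ('k::conj_div_algebra)^'n))\<^sup>2 * (norm c)\<^sup>2"
  by (simp add: norm_vec_def L2_set_def sum_nonneg norm_mult power_mult_distrib sum_distrib_right)

text \<open>Real Cauchy-Schwarz for \<open>y\<close> and the vector \<open>x c\<close> with
  \<open>c = herm x y\<close>, which has norm \<open>|x| |c|\<close>.\<close>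

lemma norm_herm_le: "norm (herm x y) \<le> norm x * norm y"
proof -
  let ?c = "herm x y"
  have n: "norm (\<chi> i. x $ i * ?c) = norm x * norm ?c"
    by (rule power2_eq_imp_eq) (simp_all add: norm_sq_vec_mult power_mult_distrib)
  have "norm ?c * norm ?c = y \<bullet> (\<chi> i. x $ i * ?c)"
    by (simp flip: inner_herm add: power2_norm_eq_inner flip: power2_eq_square)
  also have "\<dots> \<le> norm y * (norm x * norm ?c)"
    unfolding n[symmetric] by (rule norm_cauchy_schwarz)
  finally have "norm ?c * norm ?c \<le> (norm x * norm y) * norm ?c" by (simp add: mult_ac)
  then show ?thesis
    by (cases "norm ?c = 0") (auto simp: mult_le_cancel_right)
qed

text \<open>As a Gram kernel, \<open>hsq\<close> has positive semidefinite powers, is continuous,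
  and has a mean that isotropy determines.\<close>

lemma hsq_eq_inner_outer: "hsq x y = outer_self x \<bullet> outer_self y"
proof -
  have "hsq x y = herm y x \<bullet> herm y x"
    unfolding hsq_commute[of x] by (simp add: hsq_def power2_norm_eq_inner)
  also have "\<dots> = (\<Sum>i\<in>UNIV. \<Sum>j\<in>UNIV. (kconj (y $ i) * x $ i) \<bullet> (kconj (y $ j) * x $ j))"
    unfolding herm_def inner_sum_left by (simp add: inner_sum_right)
  also have "\<dots> = (\<Sum>i\<in>UNIV. \<Sum>j\<in>UNIV. (x $ i * kconj (x $ j)) \<bullet> (y $ i * kconj (y $ j)))"
  proof (intro sum.cong refl)
    fix i j
    have "(kconj (y $ i) * x $ i) \<bullet> (kconj (y $ j) * x $ j) = (kconj (y $ i) * x $ i * kconj (x $ j)) \<bullet> kconj (y $ j)"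
      by (rule inner_mult_right_adjoint[symmetric])
    also have "\<dots> = (x $ i * kconj (x $ j)) \<bullet> (y $ i * kconj (y $ j))"
      by (simp add: mult.assoc inner_mult_left_adjoint)
    finally show "(kconj (y $ i) * x $ i) \<bullet> (kconj (y $ j) * x $ j) = \<dots>" .
  qed
  also have "\<dots> = outer_self x \<bullet> outer_self y"
    by (simp add: outer_self_def inner_vec_def)
  finally show ?thesis .
qed

lemma inner_mat_outer: "mat 1 \<bullet> outer_self x = (norm (x :: ('k::conj_div_algebra)^'n))\<^sup>2"
proof -
  have "mat 1 \<bullet> outer_self x = (\<Sum>i\<in>UNIV. \<Sum>j\<in>UNIV. if i = j then (1::'k) \<bullet> (x $ i * kconj (x $ i)) else 0)"
    unfolding inner_vec_def by (intro sum.cong refl) (simp add: mat_def outer_self_def)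
  also have "\<dots> = (\<Sum>i\<in>UNIV. (norm (x $ i))\<^sup>2)"
    using inner_mult_right_adjoint[of "_" "_" "1::'k"]
    by (simp add: inner_commute[of 1] power2_norm_eq_inner)
  finally show ?thesis by (simp add: norm_vec_def L2_set_def sum_nonneg)
qed

lemma inner_mat_mat: "(mat 1 :: ('k::conj_div_algebra)^'n^'n) \<bullet> mat 1 = real CARD('n)"
proof -
  have "(mat 1 :: 'k^'n^'n) \<bullet> mat 1 = (\<Sum>i\<in>(UNIV::'n set). \<Sum>j\<in>(UNIV::'n set). if i = j then 1 else 0)"
    unfolding inner_vec_def by (intro sum.cong refl) (simp add: mat_def flip: power2_norm_eq_inner)
  then show ?thesis by simp
qed

text \<open>The summands are the \<open>t^2\<close>-coefficients in \<open>hsq_line\<close>;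
  \<open>axis i e\<close> contributes \<open>|y_i|^2\<close> for each of the \<open>DIM('k)\<close>
  unit scalars \<open>e\<close>.\<close>

lemma sum_Basis_norm_herm:
  fixes y :: "('k::conj_div_algebra)^'n"
  shows "(\<Sum>b\<in>Basis. (norm (herm y b))\<^sup>2) = real DIM('k) * (norm y)\<^sup>2"
proof -
  have B: "(Basis :: ('k^'n) set) = (\<lambda>(i, e). axis i e) ` (UNIV \<times> Basis)"
    by (auto simp: Basis_vec_def)
  have inj: "inj_on (\<lambda>(i, e). axis i e :: 'k^'n) (UNIV \<times> Basis)"
    by (auto simp: inj_on_def axis_eq_axis)
  have h: "herm y (axis i e) = kconj (y $ i) * e" for i e
  proof -
    have "herm y (axis i e) = (\<Sum>j\<in>UNIV. if j = i then kconj (y $ i) * e else 0)"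
      unfolding herm_def by (intro sum.cong) (auto simp: axis_def)
    then show ?thesis by simp
  qed
  have "(\<Sum>b\<in>Basis. (norm (herm y b))\<^sup>2) = (\<Sum>(i, e)\<in>UNIV \<times> Basis. (norm (herm y (axis i e)))\<^sup>2)"
    unfolding B by (subst sum.reindex[OF inj]) (simp add: case_prod_beta comp_def)
  also have "\<dots> = (\<Sum>i\<in>UNIV. \<Sum>e\<in>(Basis::'k set). (norm (y $ i))\<^sup>2)"
    unfolding sum.cartesian_product[symmetric]
    by (intro sum.cong refl) (simp add: h norm_mult)
  also have "\<dots> = real DIM('k) * (norm y)\<^sup>2"
    by (simp add: norm_vec_def L2_set_def sum_nonneg sum_distrib_left)
  finally show ?thesis .
qed

text \<open>The vector \<open>z = y (herm y x)\<close> represents the functional that sends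
  \<open>b\<close> to the inner product of \<open>herm y x\<close> and \<open>herm y b\<close>, so
  both claims are Parseval identities.\<close>

lemma sum_Basis_inner_herm:
  fixes x y :: "('k::conj_div_algebra)^'n"
  shows "(\<Sum>b\<in>Basis. (herm y x \<bullet> herm y b)\<^sup>2) = (norm y)\<^sup>2 * hsq x y"
    and "(\<Sum>b\<in>Basis. (x \<bullet> b) * (herm y x \<bullet> herm y b)) = hsq x y"
proof -
  let ?z = "\<chi> i. y $ i * herm y x"
  have e: "herm y x \<bullet> herm y b = ?z \<bullet> b" for b
    using inner_herm[of y b "herm y x"] by (simp add: inner_commute)
  have "(\<Sum>b\<in>Basis. (herm y x \<bullet> herm y b)\<^sup>2) = (norm ?z)\<^sup>2"
    unfolding e power2_norm_eq_inner euclidean_inner[of ?z ?z] by (simp add: power2_eq_square)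
  then show "(\<Sum>b\<in>Basis. (herm y x \<bullet> herm y b)\<^sup>2) = (norm y)\<^sup>2 * hsq x y"
    unfolding hsq_commute[of x] unfolding hsq_def by (simp add: norm_sq_vec_mult)
  have "(\<Sum>b\<in>Basis. (x \<bullet> b) * (herm y x \<bullet> herm y b)) = x \<bullet> ?z"
    unfolding e euclidean_inner[of x ?z] ..
  also have "\<dots> = herm y x \<bullet> herm y x" by (simp add: inner_herm)
  finally show "(\<Sum>b\<in>Basis. (x \<bullet> b) * (herm y x \<bullet> herm y b)) = hsq x y"
    unfolding hsq_commute[of x] unfolding hsq_def by (simp add: power2_norm_eq_inner)
qed

section \<open>Half the Laplacian\<close>

definition lagrange :: "nat \<Rightarrow> nat \<Rightarrow> real poly" where
  "lagrange n i = (\<Prod>j\<in>{..n} - {i}. smult (1 / (real i - real j)) [:- real j, 1:])"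

lemma poly_lagrange:
  assumes "i \<le> n" "j \<le> n"
  shows "poly (lagrange n i) (real j) = (if i = j then 1 else 0)"
  using assms by (auto simp: lagrange_def poly_prod intro!: prod.neutral simp flip: diff_divide_distrib)

lemma degree_lagrange:
  assumes "i \<le> n"
  shows "degree (lagrange n i) \<le> n"
proof -
  have "degree (lagrange n i) \<le> (\<Sum>j\<in>{..n} - {i}. degree (smult (1 / (real i - real j)) [:- real j, 1:]))"
    unfolding lagrange_def by (rule degree_prod_sum_le[unfolded comp_def]) simp
  also have "\<dots> \<le> (\<Sum>j\<in>{..n} - {i}. 1)"
    by (intro sum_mono) auto
  also have "\<dots> = n" using assms by simp
  finally show ?thesis .
qed

text \<open>Polynomials of degree at most \<open>n\<close> that agree at \<open>0, ..., n\<close>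
  coincide. A coefficient is thus a fixed linear combination of values, which turns differentiation
  into a finite sum of shifts.\<close>

lemma coeff_eq_lagrange:
  assumes "degree p \<le> n"
  shows "coeff p k = (\<Sum>i\<le>n. coeff (lagrange n i) k * poly p (real i))"
proof -
  have "p = (\<Sum>i\<le>n. smult (poly p (real i)) (lagrange n i))"
  proof (rule poly_eqI_degree[where A = "real ` {..n}"])
    fix x assume "x \<in> real ` {..n}"
    then obtain j where "j \<le> n" "x = real j" by auto
    then show "poly p x = poly (\<Sum>i\<le>n. smult (poly p (real i)) (lagrange n i)) x"
      by (simp add: poly_sum poly_lagrange if_distrib cong: if_cong)
  next
    show "degree p < card (real ` {..n})" using assms by (simp add: card_image)
    have "degree (\<Sum>i\<le>n. smult (poly p (real i)) (lagrange n i)) \<le> n"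
      by (intro degree_sum_le) (auto intro: order.trans[OF degree_smult_le] degree_lagrange)
    then show "degree (\<Sum>i\<le>n. smult (poly p (real i)) (lagrange n i)) < card (real ` {..n})"
      by (simp add: card_image)
  qed
  then have "coeff p k = coeff (\<Sum>i\<le>n. smult (poly p (real i)) (lagrange n i)) k" by simp
  then show ?thesis by (simp add: coeff_sum mult.commute)
qed

text \<open>On functions that are polynomials of degree at most \<open>n\<close> along every line, this finite sum of
  shifts is half the Laplacian.\<close>

definition half_laplacian :: "nat \<Rightarrow> ('a::euclidean_space \<Rightarrow> real) \<Rightarrow> 'a \<Rightarrow> real" where
  "half_laplacian n h x = (\<Sum>b\<in>Basis. \<Sum>i\<le>n. coeff (lagrange n i) 2 * h (x + real i *\<^sub>R b))"

lemma half_laplacian_sum: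
  "half_laplacian n (\<lambda>x. \<Sum>j\<in>A. c j * h j x) x = (\<Sum>j\<in>A. c j * half_laplacian n (h j) x)"
proof -
  have "half_laplacian n (\<lambda>x. \<Sum>j\<in>A. c j * h j x) x
      = (\<Sum>b\<in>Basis. \<Sum>i\<le>n. \<Sum>j\<in>A. c j * (coeff (lagrange n i) 2 * h j (x + real i *\<^sub>R b)))"
    unfolding half_laplacian_def sum_distrib_left by (intro sum.cong) (auto simp: mult_ac)
  also have "\<dots> = (\<Sum>b\<in>Basis. \<Sum>j\<in>A. \<Sum>i\<le>n. c j * (coeff (lagrange n i) 2 * h j (x + real i *\<^sub>R b)))"
    by (intro sum.cong sum.swap refl)
  also have "\<dots> = (\<Sum>j\<in>A. \<Sum>b\<in>Basis. \<Sum>i\<le>n. c j * (coeff (lagrange n i) 2 * h j (x + real i *\<^sub>R b)))"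
    by (rule sum.swap)
  finally show ?thesis by (simp add: half_laplacian_def sum_distrib_left)
qed

lemma half_laplacian_poly:
  assumes "\<And>b t. h (x + t *\<^sub>R b) = poly (p b) t" "\<And>b. degree (p b) \<le> n"
  shows "half_laplacian n h x = (\<Sum>b\<in>Basis. coeff (p b) 2)"
  unfolding half_laplacian_def assms(1) coeff_eq_lagrange[OF assms(2), of _ 2] ..

lemma coeff_quadratic_power:
  fixes a b c :: real
  shows "coeff ([:a, b, c:] ^ s) 0 = a ^ s"
    and "coeff ([:a, b, c:] ^ s) 1 = real s * a ^ (s - 1) * b"
    and "coeff ([:a, b, c:] ^ s) 2 = real s * a ^ (s - 1) * c + real s * (real s - 1) / 2 * a ^ (s - 2) * b\<^sup>2"
proof (induction s)
  case (Suc s)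
  have c0: "coeff ([:a, b, c:] ^ Suc s) 0 = a * coeff ([:a, b, c:] ^ s) 0"
    and c1: "coeff ([:a, b, c:] ^ Suc s) 1 = a * coeff ([:a, b, c:] ^ s) 1 + b * coeff ([:a, b, c:] ^ s) 0"
    and c2: "coeff ([:a, b, c:] ^ Suc s) 2 = a * coeff ([:a, b, c:] ^ s) 2 + b * coeff ([:a, b, c:] ^ s) 1
      + c * coeff ([:a, b, c:] ^ s) 0"
    by (simp_all add: numeral_2_eq_2)
  \<comment> \<open>The exponents \<open>s - 1\<close> and \<open>s - 2\<close> are truncated at 0
    for small \<open>s\<close>, but exactly there the factors in front vanish.\<close>
  have r1: "real s * (a * a ^ (s - 1)) = real s * a ^ s"
    by (cases s) auto
  have r2: "real s * (real s - 1) * (a * a ^ (s - 2)) = real s * (real s - 1) * a ^ (s - 1)"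
    by (cases s; cases "s - 1") auto
  { case 1 show ?case unfolding c0 Suc.IH by simp }
  { case 2 show ?case unfolding c1 Suc.IH using r1 by (simp add: algebra_simps) }
  { case 3
    have "coeff ([:a, b, c:] ^ Suc s) 2 = c * (real s * (a * a ^ (s - 1))) + real s * (real s - 1) * (a * a ^ (s - 2)) / 2 * b\<^sup>2
       + real s * a ^ (s - 1) * b\<^sup>2 + c * a ^ s"
      unfolding c2 Suc.IH by (simp add: algebra_simps power2_eq_square)
    also have "\<dots> = real (Suc s) * a ^ (Suc s - 1) * c + real (Suc s) * (real (Suc s) - 1) / 2 * a ^ (Suc s - 2) * b\<^sup>2"
      unfolding r1 r2 by (simp add: field_simps numeral_2_eq_2)
    finally show ?case . }
qed (simp_all add: numeral_2_eq_2)

lemma coeff_2_quadratic_powers: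
  fixes a b c :: real
  shows "coeff ([:a, b, c:] ^ s * [:a', b', c':] ^ r) 2
    = (real s * a ^ (s - 1) * c + real s * (real s - 1) / 2 * a ^ (s - 2) * b\<^sup>2) * a' ^ r
    + real s * a ^ (s - 1) * (real r * a' ^ (r - 1)) * (b * b')
    + a ^ s * (real r * a' ^ (r - 1) * c' + real r * (real r - 1) / 2 * a' ^ (r - 2) * b'\<^sup>2)"
proof -
  have "coeff (p * q) 2 = coeff p 2 * coeff q 0 + coeff p 1 * coeff q 1 + coeff p 0 * coeff q 2" for p q :: "real poly"
    by (simp add: coeff_mult numeral_2_eq_2 atMost_Suc)
  then show ?thesis by (simp only: coeff_quadratic_power) (simp add: algebra_simps)
qed

section \<open>The Laplacian on products of powers\<close>

definition hgap :: "('k::conj_div_algebra)^'n \<Rightarrow> 'k^'n \<Rightarrow> real" where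
  "hgap x y = (norm x)\<^sup>2 * (norm y)\<^sup>2 - hsq x y"

lemma hgap_commute: "hgap x y = hgap y x"
  by (simp add: hgap_def hsq_commute[of x] mult.commute)

lemma norm_line: "(norm (x + t *\<^sub>R b))\<^sup>2 = poly [:(norm x)\<^sup>2, 2 * (x \<bullet> b), (norm b)\<^sup>2:] (t::real)"
  unfolding power2_norm_eq_inner by (simp add: inner_add_left inner_add_right inner_commute algebra_simps)

lemma hsq_line: "hsq (x + t *\<^sub>R b) y
    = poly [:hsq x y, 2 * (herm y x \<bullet> herm y b), (norm (herm y b))\<^sup>2:] t"
  unfolding hsq_commute[of _ y] unfolding hsq_def herm_add_right herm_scaleR_right norm_line ..

lemma hgap_line: "hgap (x + t *\<^sub>R b) y
    = poly [:hgap x y, 2 * ((norm y)\<^sup>2 * (x \<bullet> b) - herm y x \<bullet> herm y b),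
        (norm y)\<^sup>2 * (norm b)\<^sup>2 - (norm (herm y b))\<^sup>2:] t"
  unfolding hgap_def hsq_line norm_line by (simp add: algebra_simps)

text \<open>In terms of the components of \<open>x\<close> along \<open>y\<close> and orthogonal to \<open>y\<close>, \<^term>\<open>hsq x y\<close> and \<^term>\<open>hgap x y\<close>
  are \<open>|y|\<^sup>2\<close> times their squared norms, so there is no mixed term.\<close>

lemma half_laplacian_hgap_hsq:
  fixes x y :: "('k::conj_div_algebra)^'n"
  assumes "2 * (s + r) \<le> n"
  shows "half_laplacian n (\<lambda>x. hgap x y ^ s * hsq x y ^ r) x = (norm y)\<^sup>2 *
     (real s * ((real CARD('n) - 1) * real DIM('k) + 2 * (real s - 1)) * hgap x y ^ (s - 1) * hsq x y ^ r
      + real r * (real DIM('k) + 2 * (real r - 1)) * hgap x y ^ s * hsq x y ^ (r - 1))"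
proof -
  let ?u = "hgap x y" and ?v = "hsq x y" and ?m = "real DIM('k)" and ?d = "real CARD('n)"
  \<comment> \<open>\<open>g1\<close>, \<open>g2\<close> and \<open>f1\<close>, \<open>f2\<close>
    are the first and second order coefficients of \<open>hgap\<close> and \<open>hsq\<close> along
    \<open>b\<close>.\<close>
  define g1 where "g1 b = 2 * ((norm y)\<^sup>2 * (x \<bullet> b) - herm y x \<bullet> herm y b)" for b
  define f1 where "f1 b = 2 * (herm y x \<bullet> herm y b)" for b
  define g2 where "g2 b = (norm y)\<^sup>2 * (norm b)\<^sup>2 - (norm (herm y b))\<^sup>2" for b
  define f2 where "f2 b = (norm (herm y b))\<^sup>2" for b
  define P where "P b = [:?u, g1 b, g2 b:] ^ s * [:?v, f1 b, f2 b:] ^ r" for b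
  have q: "degree [:a, b, c:] \<le> 2" for a b c :: real by simp
  have deg: "degree (P b) \<le> n" for b
  proof -
    have "degree (P b) \<le> degree ([:?u, g1 b, g2 b:] ^ s) + degree ([:?v, f1 b, f2 b:] ^ r)"
      unfolding P_def by (rule degree_mult_le)
    also have "\<dots> \<le> degree [:?u, g1 b, g2 b:] * s + degree [:?v, f1 b, f2 b:] * r"
      by (intro add_mono degree_power_le)
    also have "\<dots> \<le> 2 * s + 2 * r" by (intro add_mono mult_right_mono q) auto
    finally show ?thesis using assms by simp
  qed
  have xx: "(\<Sum>b\<in>Basis. (x \<bullet> b)\<^sup>2) = (norm x)\<^sup>2"
    unfolding power2_norm_eq_inner euclidean_inner[of x x] by (simp add: power2_eq_square)
  have S1: "(\<Sum>b\<in>Basis. f2 b) = ?m * (norm y)\<^sup>2"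
    unfolding f2_def by (rule sum_Basis_norm_herm)
  have S2: "(\<Sum>b\<in>Basis. g2 b) = (?d - 1) * ?m * (norm y)\<^sup>2"
    unfolding g2_def by (simp add: sum_subtractf sum_Basis_norm_herm algebra_simps)
  have S3: "(\<Sum>b\<in>Basis. (f1 b)\<^sup>2) = 4 * (norm y)\<^sup>2 * ?v"
    unfolding f1_def by (simp add: power_mult_distrib sum_Basis_inner_herm flip: sum_distrib_left)
  \<comment> \<open>The gradients of \<open>hgap\<close> and \<open>hsq\<close> are orthogonal,
    which removes the mixed term.\<close>
  have S4: "(\<Sum>b\<in>Basis. g1 b * f1 b) = 0"
  proof -
    have "(\<Sum>b\<in>Basis. g1 b * f1 b) = (\<Sum>b\<in>Basis. 4 * (norm y)\<^sup>2 * ((x \<bullet> b) * (herm y x \<bullet> herm y b))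
       - 4 * (herm y x \<bullet> herm y b)\<^sup>2)"
      unfolding f1_def g1_def by (intro sum.cong) (auto simp: algebra_simps power2_eq_square)
    also have "\<dots> = 0"
      by (simp add: sum_subtractf sum_Basis_inner_herm flip: sum_distrib_left)
    finally show ?thesis .
  qed
  have S5: "(\<Sum>b\<in>Basis. (g1 b)\<^sup>2) = 4 * (norm y)\<^sup>2 * ?u"
  proof -
    have "(\<Sum>b\<in>Basis. (g1 b)\<^sup>2) = (\<Sum>b\<in>Basis. 4 * (norm y)^4 * (x \<bullet> b)\<^sup>2 -
       8 * (norm y)\<^sup>2 * ((x \<bullet> b) * (herm y x \<bullet> herm y b)) + 4 * (herm y x \<bullet> herm y b)\<^sup>2)"
      unfolding g1_def by (intro sum.cong) (auto simp: algebra_simps power2_eq_square power4_eq_xxxx)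
    also have "\<dots> = 4 * (norm y)^4 * (norm x)\<^sup>2 - 8 * (norm y)\<^sup>2 * ?v + 4 * ((norm y)\<^sup>2 * ?v)"
      by (simp add: sum_subtractf sum.distrib sum_Basis_inner_herm xx flip: sum_distrib_left)
    also have "\<dots> = 4 * (norm y)\<^sup>2 * ?u"
      unfolding hgap_def by (simp add: algebra_simps power2_eq_square power4_eq_xxxx)
    finally show ?thesis .
  qed
  have "half_laplacian n (\<lambda>x. hgap x y ^ s * hsq x y ^ r) x = (\<Sum>b\<in>Basis. coeff (P b) 2)"
    by (rule half_laplacian_poly[OF _ deg])
       (simp only: hgap_line hsq_line P_def poly_mult poly_power g1_def g2_def f1_def f2_def)
  also have "\<dots> = (\<Sum>b\<in>Basis. real s * ?u ^ (s - 1) * ?v ^ r * g2 b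
      + real s * (real s - 1) / 2 * ?u ^ (s - 2) * ?v ^ r * (g1 b)\<^sup>2
      + real s * ?u ^ (s - 1) * (real r * ?v ^ (r - 1)) * (g1 b * f1 b)
      + ?u ^ s * (real r * ?v ^ (r - 1)) * f2 b
      + ?u ^ s * (real r * (real r - 1) / 2 * ?v ^ (r - 2)) * (f1 b)\<^sup>2)"
    unfolding P_def coeff_2_quadratic_powers by (intro sum.cong) (auto simp: algebra_simps)
  also have "\<dots> = real s * ?u ^ (s - 1) * ?v ^ r * ((?d - 1) * ?m * (norm y)\<^sup>2)
      + real s * (real s - 1) / 2 * ?u ^ (s - 2) * ?v ^ r * (4 * (norm y)\<^sup>2 * ?u)
      + ?u ^ s * (real r * ?v ^ (r - 1)) * (?m * (norm y)\<^sup>2)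
      + ?u ^ s * (real r * (real r - 1) / 2 * ?v ^ (r - 2)) * (4 * (norm y)\<^sup>2 * ?v)"
    unfolding sum.distrib sum_distrib_left[symmetric] S1 S2 S3 S4 S5 by simp
  also have "\<dots> = real s * ?u ^ (s - 1) * ?v ^ r * ((?d - 1) * ?m * (norm y)\<^sup>2)
      + 2 * (real s * (real s - 1) * ?u ^ (s - 2) * ?u) * ?v ^ r * (norm y)\<^sup>2
      + ?u ^ s * (real r * ?v ^ (r - 1)) * (?m * (norm y)\<^sup>2)
      + 2 * ?u ^ s * (real r * (real r - 1) * ?v ^ (r - 2) * ?v) * (norm y)\<^sup>2"
    by simp
  also have "real s * (real s - 1) * ?u ^ (s - 2) * ?u = real s * (real s - 1) * ?u ^ (s - 1)"
    by (cases s; cases "s - 1") auto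
  also have "real r * (real r - 1) * ?v ^ (r - 2) * ?v = real r * (real r - 1) * ?v ^ (r - 1)"
    by (cases r; cases "r - 1") auto
  finally show ?thesis by (simp add: algebra_simps)
qed

lemma half_laplacian_hsq:
  fixes x y :: "('k::conj_div_algebra)^'n"
  assumes "2 * r \<le> n"
  shows "half_laplacian n (\<lambda>x. hsq x y ^ r) x
    = real r * (real DIM('k) + 2 * (real r - 1)) * ((norm y)\<^sup>2 * hsq x y ^ (r - 1))"
  using half_laplacian_hgap_hsq[of 0 r n y x] assms by simp

section \<open>Positive semidefiniteness of the zonal functions\<close>

text \<open>One factor of the power is expanded over the basis and its coordinates are absorbed into
  the weights, so the induction must range over all \<open>c\<close>.\<close>

lemma inner_power_psd:
  fixes X :: "'i \<Rightarrow> 'a::euclidean_space"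
  shows "0 \<le> (\<Sum>i\<in>A. \<Sum>j\<in>A. c i * c j * (X i \<bullet> X j) ^ k)"
proof (induction k arbitrary: c)
  case 0
  have "(\<Sum>i\<in>A. \<Sum>j\<in>A. c i * c j * (X i \<bullet> X j) ^ 0) = (\<Sum>i\<in>A. c i)\<^sup>2"
    by (simp add: power2_eq_square sum_product)
  then show ?case by simp
next
  case (Suc k)
  have "(\<Sum>i\<in>A. \<Sum>j\<in>A. c i * c j * (X i \<bullet> X j) ^ Suc k)
      = (\<Sum>i\<in>A. \<Sum>j\<in>A. \<Sum>b\<in>Basis. (c i * (X i \<bullet> b)) * (c j * (X j \<bullet> b)) * (X i \<bullet> X j) ^ k)"
    by (intro sum.cong refl, subst power_Suc, subst euclidean_inner)
       (simp add: sum_distrib_left sum_distrib_right mult_ac)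
  also have "\<dots> = (\<Sum>i\<in>A. \<Sum>b\<in>Basis. \<Sum>j\<in>A. (c i * (X i \<bullet> b)) * (c j * (X j \<bullet> b)) * (X i \<bullet> X j) ^ k)"
    by (intro sum.cong refl sum.swap)
  also have "\<dots> = (\<Sum>b\<in>Basis. \<Sum>i\<in>A. \<Sum>j\<in>A. (c i * (X i \<bullet> b)) * (c j * (X j \<bullet> b)) * (X i \<bullet> X j) ^ k)"
    by (rule sum.swap)
  also have "\<dots> \<ge> 0" by (intro sum_nonneg Suc.IH)
  finally show ?case .
qed

text \<open>Membership carries explicit points and weights: a function in the span comes with a
  discrete signed measure against which kernels can be summed.\<close>

definition hsq_span :: "nat \<Rightarrow> (('k::conj_div_algebra)^'n \<Rightarrow> real) set" where
  "hsq_span k = {h. \<exists>A c. finite A \<and> h = (\<lambda>x. \<Sum>z\<in>A. c z * hsq z x ^ k)}"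

lemma hsq_spanI:
  assumes "finite A" "\<And>x. h x = (\<Sum>z\<in>A. c z * hsq z x ^ k)"
  shows "h \<in> hsq_span k"
  unfolding hsq_span_def using assms by blast

lemma hsq_span_base: "(\<lambda>x. hsq z x ^ k) \<in> hsq_span k"
  by (rule hsq_spanI[of "{z}" _ "\<lambda>_. 1"]) auto

lemma hsq_span_add:
  assumes "g \<in> hsq_span k" "h \<in> hsq_span k"
  shows "(\<lambda>x. g x + h x) \<in> hsq_span k"
proof -
  from assms obtain A c B c' where A: "finite A" "g = (\<lambda>x. \<Sum>z\<in>A. c z * hsq z x ^ k)"
    and B: "finite B" "h = (\<lambda>x. \<Sum>z\<in>B. c' z * hsq z x ^ k)"
    unfolding hsq_span_def by auto
  have "(\<Sum>z\<in>A. c z * hsq z x ^ k) + (\<Sum>z\<in>B. c' z * hsq z x ^ k)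
      = (\<Sum>z\<in>A \<union> B. ((if z \<in> A then c z else 0) + (if z \<in> B then c' z else 0)) * hsq z x ^ k)" for x
  proof -
    have "(\<Sum>z\<in>A. c z * hsq z x ^ k) = (\<Sum>z\<in>A \<union> B. (if z \<in> A then c z else 0) * hsq z x ^ k)"
      using A B by (intro sum.mono_neutral_cong_left) auto
    moreover have "(\<Sum>z\<in>B. c' z * hsq z x ^ k) = (\<Sum>z\<in>A \<union> B. (if z \<in> B then c' z else 0) * hsq z x ^ k)"
      using A B by (intro sum.mono_neutral_cong_left) auto
    ultimately show ?thesis by (simp only: distrib_right sum.distrib)
  qed
  then show ?thesis unfolding A(2) B(2) using A(1) B(1) by (intro hsq_spanI[of "A \<union> B"]) auto
qed

lemma hsq_span_scale:
  assumes "h \<in> hsq_span k"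
  shows "(\<lambda>x. c * h x) \<in> hsq_span k"
proof -
  from assms obtain A e where A: "finite A" "h = (\<lambda>x. \<Sum>z\<in>A. e z * hsq z x ^ k)"
    unfolding hsq_span_def by auto
  then show ?thesis
    by (intro hsq_spanI[of A _ "\<lambda>z. c * e z"]) (simp_all add: sum_distrib_left mult.assoc)
qed

lemma hsq_span_sum:
  assumes "\<And>i. i \<in> I \<Longrightarrow> h i \<in> hsq_span k"
  shows "(\<lambda>x. \<Sum>i\<in>I. c i * h i x) \<in> hsq_span k"
  using assms
proof (induction I rule: infinite_finite_induct)
  case (insert i I)
  then show ?case by (simp add: hsq_span_add hsq_span_scale)
\<comment> \<open>An empty or infinite index set gives the zero function, which is \<open>0\<close>
  times a base kernel.\<close>
qed (use hsq_span_scale[OF hsq_span_base, of 0] in simp_all)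

text \<open>This is the factor in \<open>half_laplacian_hsq\<close> at exponent
  \<open>Suc r\<close>; being positive, it can be divided out.\<close>

lemma laplace_factor_pos:
  "0 < real (Suc r) * (real DIM('k::euclidean_space) + 2 * (real (Suc r) - 1))"
  using DIM_positive[where 'a = 'k] by (intro mult_pos_pos add_pos_nonneg) auto

text \<open>Differentiating \<open>hsq z x ^ (k + 1)\<close> in the parameter \<open>z\<close> stays in the span, since
  \<^const>\<open>half_laplacian\<close> is a finite sum of shifts.\<close>

lemma hsq_span_norm_mult:
  fixes h :: "('k::conj_div_algebra)^'n \<Rightarrow> real"
  assumes "h \<in> hsq_span k"
  shows "(\<lambda>x. (norm x)\<^sup>2 * h x) \<in> hsq_span (Suc k)"
proof -
  have base: "(\<lambda>x. (norm x)\<^sup>2 * hsq z x ^ k) \<in> hsq_span (Suc k)" for z :: "'k^'n"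
  proof -
    define C where "C = real (Suc k) * (real DIM('k) + 2 * (real (Suc k) - 1))"
    have C: "C > 0" unfolding C_def by (rule laplace_factor_pos)
    have "C * ((norm x)\<^sup>2 * hsq z x ^ k) = half_laplacian (2 * Suc k) (\<lambda>z. hsq z x ^ Suc k) z" for x :: "'k^'n"
      unfolding C_def by (subst half_laplacian_hsq) auto
    then have e: "(norm x)\<^sup>2 * hsq z x ^ k = 1 / C * half_laplacian (2 * Suc k) (\<lambda>z. hsq z x ^ Suc k) z" for x :: "'k^'n"
      using C by (simp add: field_simps)
    show ?thesis unfolding e half_laplacian_def
      by (intro hsq_span_scale hsq_span_sum[where c = "\<lambda>_. 1", simplified] hsq_span_sum hsq_span_base)
  qed
  from assms obtain A c where A: "finite A" "h = (\<lambda>x. \<Sum>z\<in>A. c z * hsq z x ^ k)"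
    unfolding hsq_span_def by auto
  have "(\<lambda>x. (norm x)\<^sup>2 * h x) = (\<lambda>x. \<Sum>z\<in>A. c z * ((norm x)\<^sup>2 * hsq z x ^ k))"
    unfolding A(2) by (simp add: sum_distrib_left mult_ac)
  then show ?thesis by (simp only:) (intro hsq_span_sum base)
qed

lemma hsq_span_norm_power_mult:
  "(\<lambda>x. ((norm x)\<^sup>2) ^ j * hsq z x ^ k) \<in> hsq_span (j + k)"
proof (induction j)
  case (Suc j)
  from hsq_span_norm_mult[OF this] show ?case by (simp add: mult.assoc)
qed (simp add: hsq_span_base)



lemma half_laplacian_hsq':
  fixes x y :: "('k::conj_div_algebra)^'n"
  assumes "2 * r \<le> n"
  shows "half_laplacian n (\<lambda>x. hsq y x ^ r) x
    = real r * (real DIM('k) + 2 * (real r - 1)) * ((norm y)\<^sup>2 * hsq y x ^ (r - 1))"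
  using half_laplacian_hsq[OF assms, of y x] unfolding hsq_commute[of _ y] .

text \<open>The Laplacian in \<open>x\<close> lowers the exponent of \<open>hsq z x\<close> by one
  and brings out \<open>|z|^2\<close>, up to a nonzero factor. A moment that vanishes identically in
  \<open>x\<close> thus forces the next one to vanish.\<close>

lemma harmonic_moments_vanish:
  fixes A :: "(('k::conj_div_algebra)^'n) set"
  assumes harm: "\<And>x. half_laplacian (2 * k) (\<lambda>x. \<Sum>z\<in>A. c z * hsq z x ^ k) x = 0"
    and "j < k"
  shows "(\<Sum>z\<in>A. c z * ((norm z)\<^sup>2) ^ Suc j * hsq z x ^ (k - Suc j)) = 0"
  using \<open>j < k\<close>
proof (induction j arbitrary: x)
  have step: "half_laplacian (2 * k) (\<lambda>x. \<Sum>z\<in>A. c z * ((norm z)\<^sup>2) ^ i * hsq z x ^ (k - i)) x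
      = real (k - i) * (real DIM('k) + 2 * (real (k - i) - 1)) *
        (\<Sum>z\<in>A. c z * ((norm z)\<^sup>2) ^ Suc i * hsq z x ^ (k - Suc i))" for i x
    unfolding half_laplacian_sum sum_distrib_left
    by (intro sum.cong refl, subst half_laplacian_hsq') (auto simp: mult_ac)
  have pos: "real (k - i) * (real DIM('k) + 2 * (real (k - i) - 1)) \<noteq> 0" if "i < k" for i
    using laplace_factor_pos[where 'k = 'k, of "k - Suc i"] that unfolding Suc_diff_Suc[OF that] by linarith
  {
    case 0
    then show ?case using step[of 0 x] harm[of x] pos[of 0] by simp
  next
    case (Suc j)
    then have "half_laplacian (2 * k) (\<lambda>x. \<Sum>z\<in>A. c z * ((norm z)\<^sup>2) ^ Suc j * hsq z x ^ (k - Suc j)) x = 0"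
      by (simp add: half_laplacian_def)
    then show ?case using step[of "Suc j" x] pos[OF Suc.prems]
      by (simp only: mult_eq_0_iff) blast
  }
qed

text \<open>The Jacobi polynomial of \<^const>\<open>zonal\<close> (not normalised), made homogeneous in \<open>x\<close> and \<open>y\<close>: at unit
  vectors with \<open>t = |\<langle>x, y\<rangle>|\<close> the factors \<open>(1 - (2t\<^sup>2 - 1)) / 2\<close> and \<open>(1 + (2t\<^sup>2 - 1)) / 2\<close> are
  \<^term>\<open>hgap x y\<close> and \<^term>\<open>hsq x y\<close>.\<close>

definition zonal_coeff :: "nat \<Rightarrow> nat \<Rightarrow> nat \<Rightarrow> nat \<Rightarrow> real" where
  "zonal_coeff m d k s = ((real k + ((real d - 1) * (real m / 2) - 1)) gchoose (k - s)) * ((real k + (real m / 2 - 1)) gchoose s)"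

definition zonal_kernel :: "nat \<Rightarrow> ('k::conj_div_algebra)^'n \<Rightarrow> 'k^'n \<Rightarrow> real" where
  "zonal_kernel k x y = (\<Sum>s\<le>k. ((-1) ^ s * zonal_coeff DIM('k) CARD('n) k s) * (hgap x y ^ s * hsq x y ^ (k - s)))"

section \<open>Harmonicity and semidefiniteness of the zonal kernel\<close>

lemma zonal_kernel_commute: "zonal_kernel k x y = zonal_kernel k y x"
  by (simp add: zonal_kernel_def hgap_commute[of x] hsq_commute[of x])

lemma zonal_coeff_pos:
  assumes "m \<ge> 1" "d \<ge> 2" "s \<le> k"
  shows "zonal_coeff m d k s > 0"
proof -
  have *: "((real k + a) gchoose j) > 0" if "a > -1" "j \<le> k" for a :: real and j
    unfolding gbinomial_prod_rev using that by (intro divide_pos_pos prod_pos) auto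
  have "(real d - 1) * (real m / 2) > 0" using assms by (intro mult_pos_pos) auto
  then show ?thesis unfolding zonal_coeff_def using assms by (intro mult_pos_pos *) auto
qed

text \<open>Makes neighbouring terms in the Laplacian of the kernel cancel. After absorbing
  \<open>Suc r\<close> and \<open>Suc s\<close> into the binomials, it rests on
  \<open>k + a - r = s + (d - 1) m / 2\<close> and \<open>k + b - s = r + m / 2\<close>.\<close>

lemma zonal_coeff_rec:
  assumes "Suc s \<le> k"
  shows "zonal_coeff m d k s * (real (k - s) * (real m + 2 * (real (k - s) - 1)))
    = zonal_coeff m d k (Suc s) * (real (Suc s) * ((real d - 1) * real m + 2 * (real (Suc s) - 1)))"
proof -
  define a where "a = (real d - 1) * (real m / 2) - 1"
  define b where "b = real m / 2 - 1"
  define r where "r = k - Suc s"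
  have r: "k - s = Suc r" "k - Suc s = r" "real k = real s + real r + 1"
    using assms by (auto simp: r_def)
  have g: "real (Suc j) * (x gchoose Suc j) = (x - real j) * (x gchoose j)" for x :: real and j
    using gbinomial_mult_1[of x j] by (simp add: algebra_simps)
  let ?A = "(real k + a) gchoose r" and ?B = "(real k + b) gchoose s"
  have "zonal_coeff m d k s * (real (k - s) * (real m + 2 * (real (k - s) - 1)))
      = (real (Suc r) * ((real k + a) gchoose Suc r)) * ?B * (real m + 2 * real r)"
    unfolding zonal_coeff_def r a_def b_def by (simp add: mult_ac)
  also have "\<dots> = ?A * ?B * ((real k + a - real r) * (real m + 2 * real r))"
    unfolding g by (simp add: mult_ac)
  also have "(real k + a - real r) * (real m + 2 * real r) = (real k + b - real s) * ((real d - 1) * real m + 2 * real s)"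
    unfolding r(3) a_def b_def by (simp add: field_simps)
  also have "?A * ?B * \<dots> = ?A * (real (Suc s) * ((real k + b) gchoose Suc s)) * ((real d - 1) * real m + 2 * real s)"
    unfolding g by (simp add: mult_ac)
  also have "\<dots> = zonal_coeff m d k (Suc s) * (real (Suc s) * ((real d - 1) * real m + 2 * (real (Suc s) - 1)))"
    unfolding zonal_coeff_def r a_def b_def by (simp add: mult_ac)
  finally show ?thesis .
qed

lemma zonal_kernel_harmonic:
  fixes x y :: "('k::conj_div_algebra)^'n"
  shows "half_laplacian (2 * k) (\<lambda>x. zonal_kernel k x y) x = 0"
proof -
  let ?m = "DIM('k)" and ?d = "CARD('n)" and ?u = "hgap x y" and ?v = "hsq x y"
  define c where "c s = (-1) ^ s * zonal_coeff ?m ?d k s" for s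
  \<comment> \<open>\<open>P s\<close> is the part that lowers the power of \<open>hgap\<close>,
    \<open>Q s\<close> the part that lowers that of \<open>hsq\<close>. The recurrence and the
    alternating sign give \<open>P (Suc s) = - Q s\<close>; the end terms \<open>P 0\<close> and
    \<open>Q k\<close> are zero.\<close>
  define P where "P s = c s * (real s * ((real ?d - 1) * real ?m + 2 * (real s - 1))) * ?u ^ (s - 1) * ?v ^ (k - s)" for s
  define Q where "Q s = c s * (real (k - s) * (real ?m + 2 * (real (k - s) - 1))) * ?u ^ s * ?v ^ (k - s - 1)" for s
  have "half_laplacian (2 * k) (\<lambda>x. zonal_kernel k x y) x = (\<Sum>s\<le>k. (norm y)\<^sup>2 * (P s + Q s))"
    unfolding zonal_kernel_def half_laplacian_sum
    by (intro sum.cong refl, subst half_laplacian_hgap_hsq)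
       (auto simp: c_def P_def Q_def algebra_simps)
  also have "\<dots> = (norm y)\<^sup>2 * ((\<Sum>s\<le>k. P s) + (\<Sum>s\<le>k. Q s))"
    by (simp add: sum.distrib flip: sum_distrib_left)
  also have "(\<Sum>s\<le>k. P s) = (\<Sum>s<k. P (Suc s))"
    by (simp add: P_def sum.atMost_shift)
  also have "(\<Sum>s\<le>k. Q s) = (\<Sum>s<k. Q s)"
    by (simp add: Q_def flip: lessThan_Suc_atMost)
  also have "(\<Sum>s<k. P (Suc s)) = (\<Sum>s<k. - Q s)"
  proof (intro sum.cong refl)
    fix s assume "s \<in> {..<k}"
    then have "Suc s \<le> k" by simp
    from zonal_coeff_rec[OF this, of ?m ?d] show "P (Suc s) = - Q s"
      unfolding P_def Q_def c_def by (simp add: mult.assoc)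
  qed
  finally show ?thesis by (simp add: sum_negf)
qed

text \<open>The coefficient of \<open>(|x|^2 |y|^2)^i hsq^(k - i)\<close> once \<open>hgap\<close>
  is written as \<open>|x|^2 |y|^2 - hsq\<close>. The signs \<open>(-1)^s\<close> cancel against
  those of \<open>(- hsq)^s\<close>, so the leading coefficient \<open>i = 0\<close> is a sum of
  positive terms.\<close>

definition zonal_expand_coeff :: "nat \<Rightarrow> nat \<Rightarrow> nat \<Rightarrow> nat \<Rightarrow> real" where
  "zonal_expand_coeff m d k i = (-1) ^ i * (\<Sum>s\<le>k. zonal_coeff m d k s * real (s choose i))"

lemma zonal_expand_coeff_pos:
  assumes "m \<ge> 1" "d \<ge> 2"
  shows "zonal_expand_coeff m d k 0 > 0"
  unfolding zonal_expand_coeff_def using zonal_coeff_pos[OF assms] by (auto intro!: sum_pos)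

lemma zonal_kernel_expand:
  fixes x y :: "('k::conj_div_algebra)^'n"
  shows "zonal_kernel k x y = (\<Sum>i\<le>k. zonal_expand_coeff DIM('k) CARD('n) k i *
    ((norm y)\<^sup>2) ^ i * (((norm x)\<^sup>2) ^ i * hsq y x ^ (k - i)))"
proof -
  let ?a = "zonal_coeff DIM('k) CARD('n) k" and ?F = "hsq y x" and ?G = "(norm y)\<^sup>2 * (norm x)\<^sup>2"
  have t: "((-1) ^ s * ?a s) * (hgap x y ^ s * hsq x y ^ (k - s))
      = (\<Sum>i\<le>k. ?a s * real (s choose i) * (-1) ^ i * (?G ^ i * ?F ^ (k - i)))" if "s \<le> k" for s
  proof -
    have "((-1) ^ s * ?a s) * (hgap x y ^ s * hsq x y ^ (k - s)) = ?a s * ((- hgap y x) ^ s * ?F ^ (k - s))"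
      unfolding hgap_commute[of x] hsq_commute[of x] power_minus[of "hgap y x"] by (simp only: mult_ac)
    also have "- hgap y x = - ?G + ?F" by (simp add: hgap_def)
    also have "(- ?G + ?F) ^ s = (\<Sum>i\<le>s. real (s choose i) * (- ?G) ^ i * ?F ^ (s - i))"
      by (rule binomial_ring)
    also have "?a s * (\<dots> * ?F ^ (k - s)) = (\<Sum>i\<le>s. ?a s * real (s choose i) * (-1) ^ i * (?G ^ i * ?F ^ (k - i)))"
      unfolding sum_distrib_left sum_distrib_right
    proof (intro sum.cong refl)
      fix i assume "i \<in> {..s}"
      then have "?F ^ (s - i) * ?F ^ (k - s) = ?F ^ (k - i)"
        using that by (simp flip: power_add)
      then show "?a s * (real (s choose i) * (- ?G) ^ i * ?F ^ (s - i) * ?F ^ (k - s))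
          = ?a s * real (s choose i) * (-1) ^ i * (?G ^ i * ?F ^ (k - i))"
        unfolding power_minus[of ?G] by (simp add: mult_ac)
    qed
    also have "\<dots> = (\<Sum>i\<le>k. ?a s * real (s choose i) * (-1) ^ i * (?G ^ i * ?F ^ (k - i)))"
      using that by (intro sum.mono_neutral_left) (auto simp: binomial_eq_0)
    finally show ?thesis .
  qed
  have "zonal_kernel k x y = (\<Sum>s\<le>k. \<Sum>i\<le>k. ?a s * real (s choose i) * (-1) ^ i * (?G ^ i * ?F ^ (k - i)))"
    unfolding zonal_kernel_def by (intro sum.cong refl t) simp
  also have "\<dots> = (\<Sum>i\<le>k. \<Sum>s\<le>k. ?a s * real (s choose i) * (-1) ^ i * (?G ^ i * ?F ^ (k - i)))"
    by (rule sum.swap)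
  also have "\<dots> = (\<Sum>i\<le>k. zonal_expand_coeff DIM('k) CARD('n) k i *
    ((norm y)\<^sup>2) ^ i * (((norm x)\<^sup>2) ^ i * hsq y x ^ (k - i)))"
    unfolding zonal_expand_coeff_def sum_distrib_left sum_distrib_right power_mult_distrib
    by (intro sum.cong refl) (simp add: mult_ac)
  finally show ?thesis .
qed

theorem zonal_kernel_psd:
  fixes S :: "(('k::conj_div_algebra)^'n) set"
  assumes "CARD('n) \<ge> 2"
  shows "0 \<le> (\<Sum>x\<in>S. \<Sum>y\<in>S. w x * w y * zonal_kernel k x y)"
proof -
  let ?e = "zonal_expand_coeff DIM('k) CARD('n) k"
  define p where "p x = (\<Sum>y\<in>S. w y * zonal_kernel k x y)" for x
  have "(\<lambda>x. zonal_kernel k x y) \<in> hsq_span k" for y :: "'k^'n"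
    unfolding zonal_kernel_expand
  proof (rule hsq_span_sum)
    fix i assume "i \<in> {..k}"
    then show "(\<lambda>x. ((norm x)\<^sup>2) ^ i * hsq y x ^ (k - i)) \<in> hsq_span k"
      using hsq_span_norm_power_mult[of i y "k - i"] by simp
  qed
  then have "p \<in> hsq_span k"
    unfolding p_def by (intro hsq_span_sum)
  then obtain A c where p: "p = (\<lambda>x. \<Sum>z\<in>A. c z * hsq z x ^ k)"
    unfolding hsq_span_def by auto
  have "half_laplacian (2 * k) p x = 0" for x
    unfolding p_def half_laplacian_sum zonal_kernel_harmonic by simp
  then have vanish: "(\<Sum>z\<in>A. c z * ((norm z)\<^sup>2) ^ Suc j * hsq z x ^ (k - Suc j)) = 0" if "j < k" for j x
    unfolding p by (intro harmonic_moments_vanish[OF _ that])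
  \<comment> \<open>\<open>\<Sum>c(z) \<delta>\<^sub>z\<close> represents the functional "inner product with \<open>p\<close>", which sees only the leading term
    of the kernel because \<open>p\<close> is harmonic.\<close>
  have K: "(\<Sum>z\<in>A. c z * zonal_kernel k z y) = ?e 0 * p y" for y
  proof -
    have "(\<Sum>z\<in>A. c z * zonal_kernel k z y) = (\<Sum>z\<in>A. \<Sum>i\<le>k. ?e i * ((norm y)\<^sup>2) ^ i *
        (c z * ((norm z)\<^sup>2) ^ i * hsq z y ^ (k - i)))"
      unfolding zonal_kernel_expand hsq_commute[of y] sum_distrib_left
      by (intro sum.cong refl) (simp add: mult_ac)
    also have "\<dots> = (\<Sum>i\<le>k. \<Sum>z\<in>A. ?e i * ((norm y)\<^sup>2) ^ i *
        (c z * ((norm z)\<^sup>2) ^ i * hsq z y ^ (k - i)))"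
      by (rule sum.swap)
    also have "\<dots> = (\<Sum>i\<le>k. ?e i * ((norm y)\<^sup>2) ^ i * (\<Sum>z\<in>A. c z * ((norm z)\<^sup>2) ^ i * hsq z y ^ (k - i)))"
      by (simp only: sum_distrib_left)
    also have "\<dots> = ?e 0 * p y + (\<Sum>i<k. ?e (Suc i) * ((norm y)\<^sup>2) ^ Suc i *
        (\<Sum>z\<in>A. c z * ((norm z)\<^sup>2) ^ Suc i * hsq z y ^ (k - Suc i)))"
      by (subst sum.atMost_shift) (simp add: p)
    also have "\<dots> = ?e 0 * p y" by (subst sum.neutral) (simp_all add: vanish del: power_Suc)
    finally show ?thesis .
  qed
  \<comment> \<open>The sum of \<open>c z * p z\<close> is evaluated twice: by the representation of
    \<open>p\<close> it is a quadratic form in \<open>hsq ^ k\<close>, and by the definition of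
    \<open>p\<close> together with \<open>K\<close> it is \<open>?e 0\<close> times the desired
    sum.\<close>
  have "0 \<le> (\<Sum>z\<in>A. \<Sum>z'\<in>A. c z * c z' * (outer_self z \<bullet> outer_self z') ^ k)"
    by (rule inner_power_psd)
  also have "\<dots> = (\<Sum>z\<in>A. c z * p z)"
    unfolding p hsq_eq_inner_outer sum_distrib_left
    by (intro sum.cong refl) (simp add: inner_commute mult_ac)
  also have "\<dots> = (\<Sum>z\<in>A. \<Sum>y\<in>S. w y * (c z * zonal_kernel k z y))"
    unfolding p_def sum_distrib_left by (intro sum.cong refl) (simp add: mult_ac)
  also have "\<dots> = (\<Sum>y\<in>S. \<Sum>z\<in>A. w y * (c z * zonal_kernel k z y))"
    by (rule sum.swap)
  also have "\<dots> = ?e 0 * (\<Sum>y\<in>S. w y * p y)"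
    unfolding sum_distrib_left[symmetric] K by (simp add: sum_distrib_left mult_ac)
  finally have "0 \<le> (\<Sum>y\<in>S. w y * p y)"
    using zonal_expand_coeff_pos[of "DIM('k)" "CARD('n)" k] assms DIM_positive[where 'a = 'k]
    by (simp add: zero_le_mult_iff Suc_le_eq)
  then show ?thesis
    unfolding p_def sum_distrib_left by (simp add: mult_ac)
qed

section \<open>Passing to measures\<close>

lemma zonal_coeff_0: "zonal_coeff m d k 0 = poly (jacobi_poly ((real d - 1) * (real m / 2) - 1) (real m / 2 - 1) k) 1"
  by (simp add: zonal_coeff_def poly_jacobi_1)

lemma zonal_eq_kernel:
  fixes x y :: "('k::conj_div_algebra)^'n"
  assumes "norm x = 1" "norm y = 1"
  shows "zonal DIM('k) CARD('n) k (norm (herm x y)) = zonal_kernel k x y / zonal_coeff DIM('k) CARD('n) k 0"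
proof -
  let ?X = "2 * (norm (herm x y))\<^sup>2 - 1"
  have 1: "poly [:- 1/2, 1/2:] ?X = - hgap x y" "poly [:1/2, 1/2:] ?X = hsq x y"
    using assms by (simp_all add: hgap_def hsq_def field_simps)
  show ?thesis
    unfolding zonal_def Let_def zonal_coeff_0[symmetric]
    unfolding jacobi_poly_def poly_sum poly_smult poly_mult poly_power 1
      zonal_kernel_def
    unfolding zonal_coeff_def[symmetric]
    by (simp add: power_minus[of "hgap x y"] mult_ac)
qed

lemma zonal_1:
  assumes "m \<ge> 1" "d \<ge> 2"
  shows "zonal m d k 1 = 1"
  using zonal_coeff_pos[OF assms, of 0 k] by (simp add: zonal_def Let_def zonal_coeff_0)

lemma herm_axis: "herm (axis i 1) (axis j 1 :: ('k::conj_div_algebra)^'n) = (if i = j then 1 else 0)"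
proof -
  have "herm (axis i 1) (axis j 1 :: 'k^'n) = (\<Sum>l\<in>UNIV. if l = i then (if i = j then 1 else 0) else 0)"
    unfolding herm_def by (intro sum.cong refl) (auto simp: axis_def)
  then show ?thesis by simp
qed

lemma inner_axis_1: "axis i 1 \<bullet> (axis j 1 :: ('k::conj_div_algebra)^'n) = (if i = j then 1 else 0)"
  by (simp add: inner_axis_axis dot_square_norm)

text \<open>Weights \<open>1\<close> and \<open>e = 1\<close> or \<open>e = -1\<close> at two unit
  vectors with \<open>|herm x y| = t\<close> test a positive semidefinite 2 by 2 matrix with equal
  diagonal entries. The bound later justifies integrating the series termwise.\<close>

lemma abs_zonal_le_1:
  assumes "CARD('n::finite) \<ge> 2" and t: "0 \<le> t" "t \<le> 1"
  shows "\<bar>zonal DIM('k::conj_div_algebra) CARD('n) k t\<bar> \<le> 1"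
\<comment> \<open>At \<open>t = 1\<close> the two vectors would coincide and the two-point sum would
  collapse.\<close>
proof (cases "t = 1")
  case True
  then show ?thesis using assms(1) DIM_positive[where 'a = 'k] by (simp add: zonal_1 Suc_le_eq)
next
  case False
  obtain i j :: 'n where "i \<noteq> j"
  proof -
    have "\<not> (UNIV :: 'n set) \<subseteq> {undefined}"
      using card_mono[of "{undefined :: 'n}" UNIV] assms(1) by fastforce
    then show ?thesis using that by blast
  qed
  define x :: "'k^'n" where "x = axis i 1"
  define y :: "'k^'n" where "y = t *\<^sub>R axis i 1 + sqrt (1 - t\<^sup>2) *\<^sub>R axis j 1"
  have t2: "t\<^sup>2 \<le> 1" using t by (simp add: power_le_one)
  have x: "norm x = 1" by (simp add: x_def norm_eq_1 inner_axis_1)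
  have "(norm y)\<^sup>2 = t\<^sup>2 + (sqrt (1 - t\<^sup>2))\<^sup>2"
    unfolding power2_norm_eq_inner y_def using \<open>i \<noteq> j\<close>
    by (simp add: inner_add_left inner_add_right inner_axis_1 power2_eq_square)
  then have "(norm y)\<^sup>2 = 1" using t2 by simp
  then have y: "norm y = 1" by (simp add: power2_eq_1_iff) (use norm_ge_zero[of y] in linarith)
  have h: "herm x y = of_real t"
    unfolding x_def y_def herm_add_right herm_scaleR_right herm_axis using \<open>i \<noteq> j\<close> by (simp add: of_real_def)
  have xy: "x \<noteq> y"
    using h False herm_self[of x] x by auto
  define c where "c = zonal_coeff DIM('k) CARD('n) k 0"
  have c: "c > 0" unfolding c_def
    using zonal_coeff_pos[of "DIM('k)" "CARD('n)" 0 k] DIM_positive[where 'a = 'k] assms(1) by (simp add: Suc_le_eq)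
  have K1: "zonal_kernel k z z = c" if "norm z = 1" for z :: "'k^'n"
    using zonal_eq_kernel[OF that that, of k] c DIM_positive[where 'a = 'k] assms(1) that
    by (simp add: herm_self zonal_1 Suc_le_eq c_def[symmetric])
  have Kt: "zonal_kernel k x y = c * zonal DIM('k) CARD('n) k t"
    using zonal_eq_kernel[OF x y, of k] c t by (simp add: h c_def[symmetric])
  have "0 \<le> 2 * c + 2 * e * (c * zonal DIM('k) CARD('n) k t)" if "e\<^sup>2 = 1" for e
  proof -
    have "0 \<le> (\<Sum>a\<in>{x, y}. \<Sum>b\<in>{x, y}. (if a = x then 1 else e) * (if b = x then 1 else e) * zonal_kernel k a b)"
      by (rule zonal_kernel_psd[OF assms(1)])
    also have "\<dots> = 2 * c + 2 * e * (c * zonal DIM('k) CARD('n) k t)"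
      using xy that by (simp add: K1 x y Kt zonal_kernel_commute[of k y x] power2_eq_square)
    finally show ?thesis .
  qed
  from this[of 1] this[of "-1"] have "c * zonal DIM('k) CARD('n) k t \<le> c * 1" "c * (-1) \<le> c * zonal DIM('k) CARD('n) k t"
    by simp_all
  then show ?thesis using c by (simp only: mult_le_cancel_left_pos)
qed

section \<open>Integrals of positive semidefinite kernels\<close>

lemma continuous_on_outer_self: "continuous_on UNIV (outer_self :: ('k::conj_div_algebra)^'n \<Rightarrow> _)"
proof -
  have "bounded_linear (kconj :: 'k \<Rightarrow> 'k)"
    by (rule bounded_linear_intro[of _ 1]) (simp_all add: kconj_add kconj_scaleR)
  then show ?thesis unfolding outer_self_def
    by (intro continuous_intros linear_continuous_on_compose[where g = kconj])
       (auto intro!: continuous_intros bounded_linear.linear)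
qed

lemma continuous_on_hsq [continuous_intros]:
  assumes "continuous_on A f" "continuous_on A g"
  shows "continuous_on A (\<lambda>p. hsq (f p) (g p))"
  unfolding hsq_eq_inner_outer
  by (intro continuous_on_inner continuous_on_compose2[OF continuous_on_outer_self] assms) auto

lemma continuous_on_zonal_kernel: "continuous_on A (\<lambda>p. zonal_kernel k (fst p) (snd p))"
  unfolding zonal_kernel_def hgap_def by (intro continuous_intros)

lemma (in pair_sigma_finite) integral_times:
  fixes f :: "'a \<Rightarrow> real" and g :: "'b \<Rightarrow> real"
  assumes f: "integrable M1 f" and g: "integrable M2 g"
  shows "integrable (M1 \<Otimes>\<^sub>M M2) (\<lambda>p. f (fst p) * g (snd p))"
    and "(LINT p|(M1 \<Otimes>\<^sub>M M2). f (fst p) * g (snd p)) = integral\<^sup>L M1 f * integral\<^sup>L M2 g"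
proof -
  have [measurable]: "f \<in> borel_measurable M1" "g \<in> borel_measurable M2" using f g by auto
  show *: "integrable (M1 \<Otimes>\<^sub>M M2) (\<lambda>p. f (fst p) * g (snd p))"
    by (rule Fubini_integrable) (use f g in \<open>auto simp: abs_mult\<close>)
  show "(LINT p|(M1 \<Otimes>\<^sub>M M2). f (fst p) * g (snd p)) = integral\<^sup>L M1 f * integral\<^sup>L M2 g"
    using integral_fst'[OF *] by simp
qed

text \<open>Approximating \<open>u\<close> by simple functions reduces the double integral to the finite sums of the
  hypothesis \<open>psd\<close>.\<close>

lemma integral_psd_kernel:
  fixes K :: "'v::euclidean_space \<Rightarrow> 'v \<Rightarrow> real" and W :: "'a \<Rightarrow> real"
  assumes "prob_space M"
    and cont: "continuous_on UNIV (\<lambda>p. K (fst p) (snd p))"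
    and psd: "\<And>S w. 0 \<le> (\<Sum>x\<in>S. \<Sum>y\<in>S. w x * w y * K x y)"
    and W: "integrable M W" and u [measurable]: "u \<in> borel_measurable M" and u1: "\<And>x. norm (u x) \<le> 1"
  shows "integrable (M \<Otimes>\<^sub>M M) (\<lambda>p. W (fst p) * W (snd p) * K (u (fst p)) (u (snd p)))"
    and "0 \<le> (LINT p|(M \<Otimes>\<^sub>M M). W (fst p) * W (snd p) * K (u (fst p)) (u (snd p)))"
proof -
  interpret prob_space M by fact
  interpret pair_prob_space M M ..
  have [measurable]: "W \<in> borel_measurable M" using W by auto
  have "(\<lambda>p. K (fst p) (snd p)) \<in> borel_measurable borel"
    by (rule borel_measurable_continuous_onI[OF cont])
  then have [measurable]: "(\<lambda>p. K (fst p) (snd p)) \<in> borel_measurable (borel \<Otimes>\<^sub>M borel)"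
    by (simp add: borel_prod)
  have Km [measurable]: "(\<lambda>p. K (f p) (g p)) \<in> borel_measurable N"
    if [measurable]: "f \<in> borel_measurable N" "g \<in> borel_measurable N" for f g and N :: "('a \<times> 'a) measure"
  proof -
    have "(\<lambda>p. (\<lambda>p. K (fst p) (snd p)) (f p, g p)) \<in> borel_measurable N" by measurable
    then show ?thesis by simp
  qed
  obtain F where F: "\<And>i. simple_function M (F i)" "\<And>x. x \<in> space M \<Longrightarrow> (\<lambda>i. F i x) \<longlonglongrightarrow> u x"
    "\<And>i x. x \<in> space M \<Longrightarrow> norm (F i x) \<le> 2 * norm (u x)"
    using borel_measurable_implies_sequence_metric[OF u, of 0] unfolding dist_norm diff_zero by metis
  have Fm [measurable]: "F i \<in> borel_measurable M" for i
    using F(1) by (rule borel_measurable_simple_function)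
  \<comment> \<open>The approximants only satisfy \<open>|F i x| \<le> 2 |u x|\<close>, so the
    kernel has to be bounded on the ball of radius 2.\<close>
  have "compact (cball (0::'v) 2 \<times> cball (0::'v) 2)" by (intro compact_Times) auto
  then have "bounded ((\<lambda>p. K (fst p) (snd p)) ` (cball 0 2 \<times> cball 0 2))"
    by (intro compact_imp_bounded compact_continuous_image continuous_on_subset[OF cont]) auto
  then obtain C where C: "\<And>a b. norm a \<le> 2 \<Longrightarrow> norm b \<le> 2 \<Longrightarrow> \<bar>K a b\<bar> \<le> C"
    unfolding bounded_iff by (force simp: mem_cball_0)
  define G where "G i p = W (fst p) * W (snd p) * K (F i (fst p)) (F i (snd p))" for i p
  define G' where "G' p = W (fst p) * W (snd p) * K (u (fst p)) (u (snd p))" for p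
  define D where "D p = \<bar>W (fst p)\<bar> * (\<bar>W (snd p)\<bar> * C)" for p
  have D: "integrable (M \<Otimes>\<^sub>M M) D"
    unfolding D_def using W by (intro integral_times(1)[where g = "\<lambda>y. \<bar>W y\<bar> * C"]) auto
  have [measurable]: "G i \<in> borel_measurable (M \<Otimes>\<^sub>M M)" "G' \<in> borel_measurable (M \<Otimes>\<^sub>M M)" for i
    unfolding G_def G'_def by measurable
  have lim: "AE p in M \<Otimes>\<^sub>M M. (\<lambda>i. G i p) \<longlonglongrightarrow> G' p"
  proof (rule AE_I2)
    fix p assume "p \<in> space (M \<Otimes>\<^sub>M M)"
    then have "(\<lambda>i. (F i (fst p), F i (snd p))) \<longlonglongrightarrow> (u (fst p), u (snd p))"
      by (intro tendsto_Pair F) (auto simp: space_pair_measure)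
    from continuous_on_tendsto_compose[OF cont this]
    show "(\<lambda>i. G i p) \<longlonglongrightarrow> G' p" unfolding G_def G'_def by (intro tendsto_mult) auto
  qed
  have bound: "AE p in M \<Otimes>\<^sub>M M. norm (G i p) \<le> D p" for i
  proof (rule AE_I2)
    fix p assume "p \<in> space (M \<Otimes>\<^sub>M M)"
    then have "fst p \<in> space M" "snd p \<in> space M" by (auto simp: space_pair_measure)
    then have "norm (F i (fst p)) \<le> 2" "norm (F i (snd p)) \<le> 2"
      using F(3)[of "fst p" i] F(3)[of "snd p" i] u1[of "fst p"] u1[of "snd p"] by auto
    from C[OF this] show "norm (G i p) \<le> D p"
      unfolding G_def D_def by (auto simp: abs_mult mult.assoc intro!: mult_left_mono)
  qed
  have "0 \<le> integral\<^sup>L (M \<Otimes>\<^sub>M M) (G i)" for i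
  proof -
    define R where "R = F i ` space M"
    \<comment> \<open>\<open>V a\<close> is \<open>W\<close> cut off to the level set where
      \<open>F i\<close> takes the value \<open>a\<close>; the integral of \<open>G i\<close>
      becomes the finite quadratic form on \<open>R\<close> with the integrals of \<open>V a\<close>
      as weights.\<close>
    define V where "V a x = W x * indicator (F i -` {a} \<inter> space M) x" for a x
    have R: "finite R" using F(1)[of i] by (simp add: R_def simple_function_def)
    have V: "integrable M (V a)" for a
      unfolding V_def by (intro integrable_real_mult_indicator W) auto
    have G: "G i p = (\<Sum>a\<in>R. \<Sum>b\<in>R. K a b * (V a (fst p) * V b (snd p)))"
      if "p \<in> space (M \<Otimes>\<^sub>M M)" for p
    proof -
      have p: "fst p \<in> space M" "snd p \<in> space M" using that by (auto simp: space_pair_measure)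
      have "(\<Sum>a\<in>R. \<Sum>b\<in>R. K a b * (V a (fst p) * V b (snd p)))
         = (\<Sum>a\<in>R. if F i (fst p) = a then \<Sum>b\<in>R. if F i (snd p) = b then K a b * (W (fst p) * W (snd p)) else 0 else 0)"
        using p unfolding V_def by (intro sum.cong refl) (auto intro!: sum.cong simp: indicator_def)
      also have "\<dots> = G i p" using R p by (simp add: R_def G_def)
      finally show ?thesis ..
    qed
    have "integral\<^sup>L (M \<Otimes>\<^sub>M M) (G i)
        = (LINT p|(M \<Otimes>\<^sub>M M). (\<Sum>a\<in>R. \<Sum>b\<in>R. K a b * (V a (fst p) * V b (snd p))))"
      by (intro Bochner_Integration.integral_cong G refl)
    also have "\<dots> = (\<Sum>a\<in>R. \<Sum>b\<in>R. K a b * (integral\<^sup>L M (V a) * integral\<^sup>L M (V b)))"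
      by (simp add: Bochner_Integration.integral_sum Bochner_Integration.integrable_sum integral_times V)
    also have "\<dots> \<ge> 0" using psd[of "\<lambda>a. integral\<^sup>L M (V a)" R] by (simp add: mult_ac)
    finally show ?thesis .
  qed
  moreover have "(\<lambda>i. integral\<^sup>L (M \<Otimes>\<^sub>M M) (G i)) \<longlonglongrightarrow> integral\<^sup>L (M \<Otimes>\<^sub>M M) G'"
    by (rule integral_dominated_convergence[OF _ _ D lim bound]) auto
  ultimately have "0 \<le> integral\<^sup>L (M \<Otimes>\<^sub>M M) G'"
    by (intro LIMSEQ_le_const) auto
  then show "0 \<le> (LINT p|(M \<Otimes>\<^sub>M M). W (fst p) * W (snd p) * K (u (fst p)) (u (snd p)))"
    unfolding G'_def .
  have "integrable (M \<Otimes>\<^sub>M M) G'"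
    by (rule integrable_dominated_convergence[OF _ _ D lim bound]) auto
  then show "integrable (M \<Otimes>\<^sub>M M) (\<lambda>p. W (fst p) * W (snd p) * K (u (fst p)) (u (snd p)))"
    unfolding G'_def .
qed

section \<open>The energy bound\<close>

text \<open>Convexity of \<open>exp\<close> between \<open>ln r\<close> and \<open>2 * ln r\<close>,
  with weights \<open>2 - q\<close> and \<open>q - 1\<close>.\<close>

lemma powr_interpolate:
  fixes r q :: real
  assumes "r \<ge> 0" "1 \<le> q" "q \<le> 2"
  shows "r powr q \<le> (q - 1) * r\<^sup>2 + (2 - q) * r"
proof (cases "r = 0")
  case False
  then have r: "r > 0" using assms by simp
  have "r powr q = exp ((1 - (q - 1)) *\<^sub>R ln r + (q - 1) *\<^sub>R (2 * ln r))"
    using r by (simp add: powr_def algebra_simps)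
  also have "\<dots> \<le> (1 - (q - 1)) * exp (ln r) + (q - 1) * exp (2 * ln r)"
    using assms by (intro convex_onD[OF exp_convex]) auto
  also have "exp (2 * ln r) = r\<^sup>2" using r by (simp add: exp_double)
  finally show ?thesis using r by simp
qed simp

text \<open>Bounding \<open>a * b\<close> by \<open>(a^2 + b^2) / 2\<close> leaves only squares,
  whose expectations isotropy determines.\<close>

lemma powr_mult_interpolate:
  fixes a b q :: real
  assumes "a \<ge> 0" "b \<ge> 0" "1 \<le> q" "q \<le> 2"
  shows "a powr q * b powr q \<le> (q - 1) * (a\<^sup>2 * b\<^sup>2) + (2 - q) / 2 * (a\<^sup>2 + b\<^sup>2)"
proof -
  have "a powr q * b powr q = (a * b) powr q" using assms by (simp add: powr_mult)
  also have "\<dots> \<le> (q - 1) * (a * b)\<^sup>2 + (2 - q) * (a * b)"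
    using assms by (intro powr_interpolate) auto
  also have "(2 - q) * (a * b) \<le> (2 - q) * ((a\<^sup>2 + b\<^sup>2) / 2)"
    using assms sum_squares_bound[of a b] by (intro mult_left_mono) auto
  finally show ?thesis by (simp add: power_mult_distrib)
qed

text \<open>The matrix-valued mean is paired with \<open>outer_self v\<close> and with
  \<open>mat 1\<close>; the latter pairing is the trace.\<close>

lemma isotropic_integral_hsq:
  fixes \<mu> :: "(('k::conj_div_algebra)^'n) measure"
  assumes "isotropic \<mu>"
  shows "integrable \<mu> (\<lambda>x. hsq x v)" "(LINT x|\<mu>. hsq x v) = (norm v)\<^sup>2 / real CARD('n)"
    "integrable \<mu> (\<lambda>x. (norm x)\<^sup>2)" "(LINT x|\<mu>. (norm x)\<^sup>2) = 1"
proof -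
  have h: "has_bochner_integral \<mu> outer_self ((1 / real CARD('n)) *\<^sub>R (mat 1 :: 'k^'n^'n))"
    using assms by (simp add: isotropic_def)
  have "has_bochner_integral \<mu> (\<lambda>x. outer_self x \<bullet> A) (((1 / real CARD('n)) *\<^sub>R mat 1) \<bullet> A)" for A :: "'k^'n^'n"
    using h by (rule has_bochner_integral_inner_left)
  then have i: "integrable \<mu> (\<lambda>x. outer_self x \<bullet> A)" "(LINT x|\<mu>. outer_self x \<bullet> A) = (mat 1 \<bullet> A) / real CARD('n)"
    for A :: "'k^'n^'n"
    by (auto simp: has_bochner_integral_iff)
  show "integrable \<mu> (\<lambda>x. hsq x v)" "(LINT x|\<mu>. hsq x v) = (norm v)\<^sup>2 / real CARD('n)"
    unfolding hsq_eq_inner_outer using i[of "outer_self v"] by (simp_all add: inner_mat_outer)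
  show "integrable \<mu> (\<lambda>x. (norm x)\<^sup>2)" "(LINT x|\<mu>. (norm x)\<^sup>2) = 1"
    using i[of "mat 1"] unfolding inner_commute[of "outer_self _"] by (simp_all add: inner_mat_outer inner_mat_mat)
qed

lemma hsq_scaleR_right: "hsq x (r *\<^sub>R y) = r\<^sup>2 * hsq x y"
  by (simp add: hsq_def herm_scaleR_right power_mult_distrib)

lemma hsq_scaleR_left: "hsq (r *\<^sub>R x) y = r\<^sup>2 * hsq x y"
  unfolding hsq_commute[of _ y] by (rule hsq_scaleR_right)

lemma hsq_le: "hsq x y \<le> (norm x)\<^sup>2 * (norm y)\<^sup>2"
  unfolding hsq_def power_mult_distrib[symmetric] by (intro power_mono norm_herm_le) auto

lemma hsq_nonneg: "0 \<le> hsq x y"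
  by (simp add: hsq_def)

section \<open>The expectation bound, uniformly in the scalars\<close>

lemma zonal_potential_bound:
  fixes \<mu> :: "(('k::conj_div_algebra)^'n) measure"
  assumes d: "CARD('n) \<ge> 2"
    and q: "1 \<le> q" "q \<le> 2"
    and f: "f \<in> borel_measurable (restrict_space borel {0..1})"
    and a: "a 0 \<ge> 0" "a 1 \<ge> 0" "\<And>k. k \<ge> 2 \<Longrightarrow> a k \<le> 0"
    and dom: "zonal_dominated DIM('k) CARD('n) a f"
    and iso: "isotropic \<mu>"
  shows "integrable (\<mu> \<Otimes>\<^sub>M \<mu>) (\<lambda>(x, y). pot q f x y) \<and>
    (LINT (x, y)|(\<mu> \<Otimes>\<^sub>M \<mu>). pot q f x y) = (LINT x|\<mu>. LINT y|\<mu>. pot q f x y) \<and>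
    (LINT x|\<mu>. LINT y|\<mu>. pot q f x y) \<le> a 1 / real CARD('n) + a 0"
proof -
  have prob: "prob_space \<mu>" and sets [measurable_cong]: "sets \<mu> = sets borel"
    using iso by (simp_all add: isotropic_def)
  interpret mu: prob_space \<mu> by (fact prob)
  interpret pair_prob_space \<mu> \<mu> ..
  let ?P = "\<mu> \<Otimes>\<^sub>M \<mu>" and ?d = "real CARD('n)"
  note I = isotropic_integral_hsq[OF iso]
  have I2': "(LINT y|\<mu>. hsq x y) = (norm x)\<^sup>2 / ?d" for x
    using I(2)[of x] unfolding hsq_commute[of x] .
  \<comment> \<open>Polar decomposition of the potential: as \<open>W 0 = 0\<close>, the product
    \<open>w p * f (T p)\<close> vanishes whenever a point is the origin, just as \<open>pot\<close>
    does.\<close>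
  define W where "W x = norm x powr q" for x :: "'k^'n"
  define u where "u x = x /\<^sub>R norm x" for x :: "'k^'n"
  define w where "w p = W (fst p) * W (snd p)" for p
  define T where "T p = norm (herm (u (fst p)) (u (snd p)))" for p
  define c where "c k = zonal_coeff DIM('k) CARD('n) k 0" for k
  \<comment> \<open>The series term of index \<open>k + 2\<close>, written with the kernel instead
    of \<open>zonal\<close> so that \<open>integral_psd_kernel\<close> applies even where
    \<open>u\<close> is 0.\<close>
  define g where "g k p = a (k + 2) * (w p * zonal_kernel (k + 2) (u (fst p)) (u (snd p)) / c (k + 2))" for k p
  have m: "DIM('k) \<ge> 1" using DIM_positive[where 'a = 'k] by (simp add: Suc_le_eq)
  have c: "c k > 0" for k unfolding c_def by (intro zonal_coeff_pos m d) auto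
  have [measurable]: "W \<in> borel_measurable \<mu>" "u \<in> borel_measurable \<mu>"
    unfolding W_def u_def by measurable
  have u1: "norm (u x) \<le> 1" "x \<noteq> 0 \<Longrightarrow> norm (u x) = 1" for x
    by (cases "x = 0"; simp add: u_def)+
  have W0: "W x \<ge> 0" "W 0 = 0" for x by (simp_all add: W_def)
  have w0: "w p \<ge> 0" for p by (simp add: w_def W0)
  have T2: "(T p)\<^sup>2 = hsq (u (fst p)) (u (snd p))" for p by (simp add: T_def hsq_def)
  have T01: "T p \<in> {0..1}" for p
    using order.trans[OF norm_herm_le mult_mono[OF u1(1) u1(1)]] by (auto simp: T_def)
  have out [measurable]: "outer_self \<in> borel_measurable (borel :: ('k^'n) measure)"
    by (rule borel_measurable_continuous_onI[OF continuous_on_outer_self])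
  have hsq_m [measurable]: "(\<lambda>p. hsq (g p) (h p)) \<in> borel_measurable N"
    if [measurable]: "g \<in> borel_measurable N" "h \<in> borel_measurable N" for g h :: "_ \<Rightarrow> 'k^'n" and N :: "(('k^'n) \<times> ('k^'n)) measure"
    unfolding hsq_eq_inner_outer by measurable
  have Tm: "T \<in> borel_measurable ?P"
  proof -
    have "T = (\<lambda>p. sqrt (hsq (u (fst p)) (u (snd p))))" by (auto simp: T_def hsq_def)
    then show ?thesis by simp
  qed
  have fT [measurable]: "(\<lambda>p. f (T p)) \<in> borel_measurable ?P"
    by (rule measurable_compose[OF measurable_restrict_space2[OF _ Tm] f]) (use T01 in auto)
  have pot: "pot q f (fst p) (snd p) = w p * f (T p)" for p
    by (auto simp: pot_def w_def T_def W_def u_def)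

  note prod = integral_times[OF I(3) I(3)]
  have i1: "integrable ?P (\<lambda>p. (norm (fst p))\<^sup>2)" "(LINT p|?P. (norm (fst p))\<^sup>2) = 1"
    using integral_times[OF I(3), of "\<lambda>_. 1"] I(4) by (simp_all add: mu.prob_space)
  have i2: "integrable ?P (\<lambda>p. (norm (snd p))\<^sup>2)" "(LINT p|?P. (norm (snd p))\<^sup>2) = 1"
    using integral_times[OF _ I(3), of "\<lambda>_. 1"] I(4) by (simp_all add: mu.prob_space)
  \<comment> \<open>The majorant of \<open>w\<close> from \<open>powr_mult_interpolate\<close>; its
    integral is \<open>(q - 1) + (2 - q) = 1\<close>.\<close>
  define B where "B p = (q - 1) * ((norm (fst p))\<^sup>2 * (norm (snd p))\<^sup>2)
    + (2 - q) / 2 * ((norm (fst p))\<^sup>2 + (norm (snd p))\<^sup>2)" for p :: "('k^'n) \<times> ('k^'n)"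
  have wB: "w p \<le> B p" for p
    unfolding w_def W_def B_def using q by (intro powr_mult_interpolate) auto
  have B: "integrable ?P B" unfolding B_def using prod(1) i1(1) i2(1) by auto
  have B1: "integral\<^sup>L ?P B = 1"
    unfolding B_def using prod i1 i2 I(4) by (simp add: field_simps)
  have wm [measurable]: "w \<in> borel_measurable ?P" unfolding w_def by measurable
  have wi: "integrable ?P w"
  proof (rule Bochner_Integration.integrable_bound[OF B wm], rule AE_I2)
    show "norm (w p) \<le> norm (B p)" for p using w0[of p] wB[of p] by simp
  qed
  have w1: "integral\<^sup>L ?P w \<le> 1"
    using integral_mono[OF wi B wB] B1 by simp
  have Wi: "integrable \<mu> W"
  proof (rule Bochner_Integration.integrable_bound)
    show "integrable \<mu> (\<lambda>x. 1 + (norm x)\<^sup>2)" using I(3) by simp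
    show "AE x in \<mu>. norm (W x) \<le> norm (1 + (norm x)\<^sup>2)"
    proof (rule AE_I2)
      fix x :: "'k^'n"
      have "norm x powr q * 1 powr q \<le> (q - 1) * ((norm x)\<^sup>2 * 1\<^sup>2) + (2 - q) / 2 * ((norm x)\<^sup>2 + 1\<^sup>2)"
        using q by (intro powr_mult_interpolate) auto
      also have "\<dots> = q / 2 * (norm x)\<^sup>2 + (2 - q) / 2" by (simp add: field_simps)
      also have "\<dots> \<le> 1 * (norm x)\<^sup>2 + 1" using q by (intro add_mono mult_right_mono) auto
      finally show "norm (W x) \<le> norm (1 + (norm x)\<^sup>2)" by (simp add: W_def)
    qed
  qed simp

  \<comment> \<open>\<open>H\<close> is \<open>B * T^2\<close> with the norms absorbed by
    homogeneity. Each term keeps an unnormalised argument, over which isotropy can be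
    integrated.\<close>
  define H where "H p = (q - 1) * hsq (fst p) (snd p)
    + (2 - q) / 2 * (hsq (fst p) (u (snd p)) + hsq (u (fst p)) (snd p))" for p
  have un: "(norm x)\<^sup>2 * hsq (u x) y = hsq x y" for x y
    by (cases "x = 0") (simp_all add: u_def hsq_scaleR_left power_inverse, simp add: hsq_def herm_def)
  have BH: "B p * (T p)\<^sup>2 = H p" for p
  proof -
    have "B p * (T p)\<^sup>2 = (q - 1) * ((norm (fst p))\<^sup>2 * ((norm (snd p))\<^sup>2 * hsq (u (snd p)) (u (fst p))))
      + (2 - q) / 2 * ((norm (fst p))\<^sup>2 * hsq (u (fst p)) (u (snd p)) + (norm (snd p))\<^sup>2 * hsq (u (snd p)) (u (fst p)))"
      unfolding B_def T2 hsq_commute[of "u (snd p)"] by (simp add: algebra_simps)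
    also have "\<dots> = H p"
      unfolding un H_def hsq_commute[of "snd p"] un ..
    finally show ?thesis .
  qed
  have h0: "integrable ?P (\<lambda>p. hsq (fst p) (snd p))"
    by (rule Bochner_Integration.integrable_bound[OF prod(1)]) (auto simp: hsq_nonneg hsq_le)
  have h1: "integrable ?P (\<lambda>p. hsq (fst p) (u (snd p)))"
  proof (rule Bochner_Integration.integrable_bound[OF i1(1)])
    have "hsq x (u y) \<le> (norm x)\<^sup>2 * 1\<^sup>2" for x y
      by (rule order.trans[OF hsq_le]) (intro mult_left_mono power_mono u1, auto)
    then show "AE p in ?P. norm (hsq (fst p) (u (snd p))) \<le> norm ((norm (fst p))\<^sup>2)"
      by (simp add: hsq_nonneg)
  qed simp
  have h2: "integrable ?P (\<lambda>p. hsq (u (fst p)) (snd p))"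
  proof (rule Bochner_Integration.integrable_bound[OF i2(1)])
    have "hsq (u x) y \<le> 1\<^sup>2 * (norm y)\<^sup>2" for x y
      by (rule order.trans[OF hsq_le]) (intro mult_right_mono power_mono u1, auto)
    then show "AE p in ?P. norm (hsq (u (fst p)) (snd p)) \<le> norm ((norm (snd p))\<^sup>2)"
      by (simp add: hsq_nonneg)
  qed simp
  \<comment> \<open>Only an inequality, because \<open>u 0 = 0\<close> and \<open>\<mu>\<close> may
    charge the origin.\<close>
  have un1: "(LINT x|\<mu>. (norm (u x))\<^sup>2 / ?d) \<le> 1 / ?d"
  proof -
    have "(LINT x|\<mu>. (norm (u x))\<^sup>2 / ?d) \<le> (LINT x|\<mu>. 1 / ?d)"
      by (rule integral_mono')
         (auto intro!: divide_right_mono power_le_one u1)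
    then show ?thesis by (simp add: mu.prob_space)
  qed
  have j0: "(LINT p|?P. hsq (fst p) (snd p)) = 1 / ?d"
    using integral_fst'[OF h0] I(4) by (simp add: I2')
  \<comment> \<open>The unnormalised argument, here the first, is integrated out first.\<close>
  have j1: "(LINT p|?P. hsq (fst p) (u (snd p))) \<le> 1 / ?d"
    using integral_snd[of "\<lambda>x y. hsq x (u y)"] h1 un1 by (simp add: I(2) case_prod_beta')
  have j2: "(LINT p|?P. hsq (u (fst p)) (snd p)) \<le> 1 / ?d"
    using integral_fst'[OF h2] un1 by (simp add: I2')
  have H: "integrable ?P H" unfolding H_def using h0 h1 h2 by auto
  have "integral\<^sup>L ?P H = (q - 1) * (1 / ?d) + (2 - q) / 2 * ((LINT p|?P. hsq (fst p) (u (snd p))) + (LINT p|?P. hsq (u (fst p)) (snd p)))"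
    unfolding H_def using h0 h1 h2 by (simp add: j0)
  also have "\<dots> \<le> (q - 1) * (1 / ?d) + (2 - q) / 2 * (1 / ?d + 1 / ?d)"
    using q by (intro add_mono mult_left_mono j1 j2) auto
  also have "\<dots> = 1 / ?d" by (simp add: field_simps)
  finally have H1: "integral\<^sup>L ?P H \<le> 1 / ?d" .
  have wTi: "integrable ?P (\<lambda>p. w p * (T p)\<^sup>2)"
  proof (rule Bochner_Integration.integrable_bound[OF wi], use Tm in measurable, rule AE_I2)
    show "norm (w p * (T p)\<^sup>2) \<le> norm (w p)" for p
      using w0[of p] T01[of p] by (auto simp: abs_mult intro!: mult_left_le power_le_one)
  qed
  have "integral\<^sup>L ?P (\<lambda>p. w p * (T p)\<^sup>2) \<le> integral\<^sup>L ?P H"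
    by (rule integral_mono[OF wTi H]) (auto simp flip: BH intro!: mult_right_mono wB)
  then have wT1: "integral\<^sup>L ?P (\<lambda>p. w p * (T p)\<^sup>2) \<le> 1 / ?d" using H1 by simp

  have gk: "integrable ?P (g k)" "integral\<^sup>L ?P (g k) \<le> 0" for k
  proof -
    have K: "continuous_on UNIV (\<lambda>p. zonal_kernel (k + 2) (fst p :: 'k^'n) (snd p))"
      by (rule continuous_on_zonal_kernel)
    note psd = integral_psd_kernel[OF prob K zonal_kernel_psd[OF d] Wi _ u1(1)]
    have i: "integrable ?P (\<lambda>p. w p * zonal_kernel (k + 2) (u (fst p)) (u (snd p)))"
      and n: "0 \<le> (LINT p|?P. w p * zonal_kernel (k + 2) (u (fst p)) (u (snd p)))"
      unfolding w_def by (rule psd; simp)+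
    show "integrable ?P (g k)" unfolding g_def using i by simp
    have "integral\<^sup>L ?P (g k) = a (k + 2) * ((LINT p|?P. w p * zonal_kernel (k + 2) (u (fst p)) (u (snd p))) / c (k + 2))"
      unfolding g_def by simp
    also have "\<dots> \<le> 0" using a(3)[of "k + 2"] n c[of "k + 2"] by (intro mult_nonpos_nonneg) auto
    finally show "integral\<^sup>L ?P (g k) \<le> 0" .
  qed
  have gz: "g k p = w p * (a (k + 2) * zonal DIM('k) CARD('n) (k + 2) (T p))" for k p
  proof (cases "fst p = 0 \<or> snd p = 0")
    case True
    then have "w p = 0" by (auto simp: w_def W0)
    then show ?thesis by (simp add: g_def)
  next
    case False
    then show ?thesis
      unfolding T_def by (subst zonal_eq_kernel) (auto simp: u1 g_def c_def)
  qed
  have z1: "\<bar>zonal DIM('k) CARD('n) k (T p)\<bar> \<le> 1" for k p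
    using abs_zonal_le_1[OF d, of "T p"] T01[of p] by auto
  \<comment> \<open>Convergence at \<open>t = 1\<close>, where every zonal function is 1, and the
    constant sign of the tail coefficients yield absolute summability, hence a series dominating
    \<open>g\<close> everywhere.\<close>
  have "summable (\<lambda>k. a (k + 2) * zonal DIM('k) CARD('n) (k + 2) 1)"
    using dom unfolding zonal_dominated_def by auto
  then have sa: "summable (\<lambda>k. \<bar>a (k + 2)\<bar>)"
    using summable_minus[of "\<lambda>k. a (k + 2)"] a(3) by (simp add: zonal_1[OF m d] abs_of_nonpos)
  have gb: "norm (g k p) \<le> \<bar>a (k + 2)\<bar> * w p" for k p
  proof -
    have "norm (g k p) = (\<bar>a (k + 2)\<bar> * w p) * \<bar>zonal DIM('k) CARD('n) (k + 2) (T p)\<bar>"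
      unfolding gz using w0[of p] by (simp add: abs_mult)
    also have "\<dots> \<le> (\<bar>a (k + 2)\<bar> * w p) * 1"
      using w0[of p] by (intro mult_left_mono z1) auto
    finally show ?thesis by simp
  qed
  have sg: "summable (\<lambda>k. norm (g k p))" for p
    by (rule summable_comparison_test[OF _ summable_mult2[OF sa, of "w p"]]) (use gb in auto)
  have sI: "summable (\<lambda>k. LINT p|?P. norm (g k p))"
  proof (rule summable_comparison_test[OF _ summable_mult2[OF sa, of "integral\<^sup>L ?P w"]], intro exI allI impI)
    fix k
    have "(LINT p|?P. norm (g k p)) \<le> (LINT p|?P. \<bar>a (k + 2)\<bar> * w p)"
      using gk(1) wi gb by (intro integral_mono) auto
    then show "norm (LINT p|?P. norm (g k p)) \<le> \<bar>a (k + 2)\<bar> * integral\<^sup>L ?P w" by simp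
  qed
  have S: "integrable ?P (\<lambda>p. \<Sum>k. g k p)" "(LINT p|?P. (\<Sum>k. g k p)) = (\<Sum>k. integral\<^sup>L ?P (g k))"
    "summable (\<lambda>k. integral\<^sup>L ?P (g k))"
    using integrable_suminf[OF gk(1) AE_I2[OF sg] sI] integral_suminf[OF gk(1) AE_I2[OF sg] sI]
      summable_integral[OF gk(1) AE_I2[OF sg] sI] by auto
  have S0: "(LINT p|?P. (\<Sum>k. g k p)) \<le> 0"
    unfolding S(2) using suminf_le[OF gk(2) S(3) summable_zero] by simp

  define R where "R p = a 0 * w p + a 1 * (w p * (T p)\<^sup>2) + (\<Sum>k. g k p)" for p
  have R: "integrable ?P R" unfolding R_def using wi wTi S(1) by auto
  have R1: "integral\<^sup>L ?P R \<le> a 1 / ?d + a 0"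
  proof -
    have "integral\<^sup>L ?P R = a 0 * integral\<^sup>L ?P w + a 1 * (LINT p|?P. w p * (T p)\<^sup>2) + (LINT p|?P. (\<Sum>k. g k p))"
      unfolding R_def using wi wTi S(1) by simp
    also have "\<dots> \<le> a 0 * 1 + a 1 * (1 / ?d) + 0"
      using a by (intro add_mono mult_left_mono w1 wT1 S0) auto
    finally show ?thesis by simp
  qed
  have domT: "summable (\<lambda>k. a (k + 2) * zonal DIM('k) CARD('n) (k + 2) (T p))" "0 \<le> f (T p)"
    "f (T p) \<le> a 0 + a 1 * (T p)\<^sup>2 + (\<Sum>k. a (k + 2) * zonal DIM('k) CARD('n) (k + 2) (T p))" for p
    using dom T01[of p] unfolding zonal_dominated_def by blast+
  have le: "w p * f (T p) \<le> R p" for p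
  proof -
    have "w p * f (T p) \<le> w p * (a 0 + a 1 * (T p)\<^sup>2 + (\<Sum>k. a (k + 2) * zonal DIM('k) CARD('n) (k + 2) (T p)))"
      by (intro mult_left_mono domT w0)
    also have "\<dots> = R p"
      unfolding R_def gz suminf_mult[OF domT(1)] by (simp only: algebra_simps)
    finally show ?thesis .
  qed
  \<comment> \<open>With nonnegativity the upper bound \<open>R\<close> also controls the absolute
    value, which gives integrability.\<close>
  have nonneg: "0 \<le> w p * f (T p)" for p by (intro mult_nonneg_nonneg w0 domT)
  have int: "integrable ?P (\<lambda>p. w p * f (T p))"
  proof (rule Bochner_Integration.integrable_bound[OF R])
    show "(\<lambda>p. w p * f (T p)) \<in> borel_measurable ?P" by simp
    show "AE p in ?P. norm (w p * f (T p)) \<le> norm (R p)"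
      using nonneg le by (intro AE_I2) (simp add: order.trans[OF le abs_ge_self])
  qed
  have cp: "(\<lambda>(x, y). pot q f x y) = (\<lambda>p. w p * f (T p))" by (auto simp flip: pot)
  have "(LINT p|?P. w p * f (T p)) \<le> integral\<^sup>L ?P R" by (intro integral_mono int R le)
  then have "(LINT (x, y)|?P. pot q f x y) \<le> a 1 / ?d + a 0" unfolding cp using R1 by simp
  moreover have "integrable ?P (\<lambda>(x, y). pot q f x y)" unfolding cp by (rule int)
  ultimately show ?thesis using integral_fst[of "pot q f"] by simp
qed

theorem theorem2:
  fixes q :: real and f :: "real \<Rightarrow> real" and a :: "nat \<Rightarrow> real"
  assumes "CARD('n::finite) \<ge> 2"
    and "1 \<le> q" and "q \<le> 2"
    and "f \<in> borel_measurable (restrict_space borel {0..1})"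
    and "a 0 \<ge> 0" and "a 1 \<ge> 0" and "\<And>k. k \<ge> 2 \<Longrightarrow> a k \<le> 0"
  shows
   "(zonal_dominated DIM(real) CARD('n) a f \<longrightarrow>
      (\<forall>\<mu> :: (real^'n) measure. isotropic \<mu> \<longrightarrow>
         integrable (\<mu> \<Otimes>\<^sub>M \<mu>) (\<lambda>(x, y). pot q f x y) \<and>
         (LINT (x, y)|(\<mu> \<Otimes>\<^sub>M \<mu>). pot q f x y) = (LINT x|\<mu>. LINT y|\<mu>. pot q f x y) \<and>
         (LINT x|\<mu>. LINT y|\<mu>. pot q f x y) \<le> a 1 / real CARD('n) + a 0)) \<and>
    (zonal_dominated DIM(complex) CARD('n) a f \<longrightarrow>
      (\<forall>\<mu> :: (complex^'n) measure. isotropic \<mu> \<longrightarrow>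
         integrable (\<mu> \<Otimes>\<^sub>M \<mu>) (\<lambda>(x, y). pot q f x y) \<and>
         (LINT (x, y)|(\<mu> \<Otimes>\<^sub>M \<mu>). pot q f x y) = (LINT x|\<mu>. LINT y|\<mu>. pot q f x y) \<and>
         (LINT x|\<mu>. LINT y|\<mu>. pot q f x y) \<le> a 1 / real CARD('n) + a 0)) \<and>
    (zonal_dominated DIM(quat) CARD('n) a f \<longrightarrow>
      (\<forall>\<mu> :: (quat^'n) measure. isotropic \<mu> \<longrightarrow>
         integrable (\<mu> \<Otimes>\<^sub>M \<mu>) (\<lambda>(x, y). pot q f x y) \<and>
         (LINT (x, y)|(\<mu> \<Otimes>\<^sub>M \<mu>). pot q f x y) = (LINT x|\<mu>. LINT y|\<mu>. pot q f x y) \<and>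
         (LINT x|\<mu>. LINT y|\<mu>. pot q f x y) \<le> a 1 / real CARD('n) + a 0))"
  by (rule conjI[OF impI conjI[OF impI impI]])
    (rule allI, rule impI, rule zonal_potential_bound, (rule assms | assumption)+)+

end
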